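(* Let $\mu\in[0,1)$ be fixed, and let $v_k^{\eta}$ ($\eta>0$) be the iterates of Async-MSGD for streaming PCA (see context) with step size $\eta$, momentum $\mu$ and delays $\tau_k$. Suppose that $v_{-i}=v_0=v_1\in\mathbb{S}$ for any $i>0$, and that the delay in each step is chosen according to $$\tau_k\asymp \frac{(1-\mu)^2}{\lambda_1\eta^{1-\gamma}},\qquad \forall k>0,$$ for some $\gamma\in(0,1]$. Let $V^{\eta}(t)=v_k^{\eta}$ for $t\in[k\eta,k\eta+\eta)$. Then for each subsequence of $\{V^{\eta}(\cdot),\eta>0\}$ there exist a further subsequence and a process $V(\cdot)$ such that $V^{\eta}(\cdot)\Rightarrow V(\cdot)$ in the weak sense as $\eta\to0$ through the convergent subsequence, where $V(\cdot)$ satisfies the ODE $$\dot V=\frac{1}{1-\mu}\left[\Sigma V-(V^{\top}\Sigma V)V\right],\qquad V(0)=v_0 .$$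
   Context: Data: $\{X_k\}$ are drawn independently from a distribution $\mathcal{D}$ on $\mathbb{R}^d$ with $\mathbb{E}[X]=0$, $\mathbb{E}[XX^\top]=\Sigma$ and $\|X\|\le C_d$ for a constant $C_d$ (possibly depending on $d$). $\Sigma$ is positive definite with eigenvalues $\lambda_1>\lambda_2\ge\dots\ge\lambda_d>0$. $\mathbb{S}=\{v\in\mathbb{R}^d:\|v\|=1\}$. Async-MSGD: with step size $\eta>0$, momentum $\mu\in[0,1)$ and delays $\tau_k\in\mathbb{Z}_{+}$ (nonnegative integers), $$v_{k+1}=v_k+\mu(v_k-v_{k-1})+\eta\,(I-v_{k-\tau_k}v_{k-\tau_k}^{\top})X_kX_k^{\top}v_{k-\tau_k}.$$ The iterates and the delays depend on $\eta$. The symbol $\asymp$ means asymptotically equal (of the same order as $\eta\to0$). Weak convergence is understood for processes with paths in the space of càdlàg $\mathbb{R}^d$-valued functions on $[0,\infty)$. *)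

theory Defs
  imports "HOL-Probability.Probability"
begin

section \<open>The Skorokhod space of cadlag paths on the half-line\<close>

text \<open>Paths live on \<open>[0,\<infinity>)\<close>; \<^const>\<open>extensional\<close> fixes the irrelevant values at
  negative times, so that equality of paths is equality on \<open>[0,\<infinity>)\<close>.\<close>

definition cadlag_paths :: "(real \<Rightarrow> 'a::metric_space) set" where
  "cadlag_paths = {x \<in> extensional {0..}.
     (\<forall>t\<ge>0. (x \<longlongrightarrow> x t) (at_right t)) \<and>
     (\<forall>t>0. \<exists>l. (x \<longlongrightarrow> l) (at_left t))}"

definition time_changes :: "(real \<Rightarrow> real) set" where
  "time_changes = {l. strict_mono_on {0..} l \<and> l ` {0..} = {0..}}"

definition skorokhod_nbhd ::
    "(real \<Rightarrow> 'a::metric_space) \<Rightarrow> real \<Rightarrow> real \<Rightarrow> (real \<Rightarrow> 'a) set" where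
  "skorokhod_nbhd x T \<epsilon> = {y \<in> cadlag_paths. \<exists>l\<in>time_changes. \<forall>t\<in>{0..T}.
     \<bar>l t - t\<bar> < \<epsilon> \<and> dist (y t) (x (l t)) < \<epsilon>}"

text \<open>Skorokhod's J1 topology.  A sequence \<open>y\<^sub>n\<close> is eventually in every \<^const>\<open>skorokhod_nbhd\<close>
  of \<open>x\<close> iff for each \<open>T\<close> there are time changes \<open>l\<^sub>n\<close> such that \<open>l\<^sub>n t - t\<close> and
  \<open>dist (y\<^sub>n t) (x (l\<^sub>n t))\<close> tend to 0 uniformly on \<open>[0,T]\<close>; this is convergence in the usual
  Skorokhod metric (Ethier and Kurtz, Markov Processes, Proposition 3.5.3).  As that metric
  topology is determined by its convergent sequences, its open sets are the ones below.\<close>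

definition skorokhod_topology :: "(real \<Rightarrow> 'a::metric_space) topology" where
  "skorokhod_topology = topology (\<lambda>U. U \<subseteq> cadlag_paths \<and>
     (\<forall>x\<in>U. \<exists>T>0. \<exists>\<epsilon>>0. skorokhod_nbhd x T \<epsilon> \<subseteq> U))"

lemma skorokhod_nbhd_mono:
  assumes "T \<le> T'" "\<epsilon>' \<le> \<epsilon>"
  shows "skorokhod_nbhd x T' \<epsilon>' \<subseteq> skorokhod_nbhd x T \<epsilon>"
proof
  fix y assume "y \<in> skorokhod_nbhd x T' \<epsilon>'"
  then obtain l where l: "y \<in> cadlag_paths" "l \<in> time_changes"
    "\<forall>t\<in>{0..T'}. \<bar>l t - t\<bar> < \<epsilon>' \<and> dist (y t) (x (l t)) < \<epsilon>'"
    unfolding skorokhod_nbhd_def by blast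
  have "\<bar>l t - t\<bar> < \<epsilon> \<and> dist (y t) (x (l t)) < \<epsilon>" if "t \<in> {0..T}" for t
  proof -
    have "t \<in> {0..T'}" using that assms(1) by auto
    then show ?thesis using l(3) assms(2) by fastforce
  qed
  then show "y \<in> skorokhod_nbhd x T \<epsilon>"
    using l(1,2) unfolding skorokhod_nbhd_def by blast
qed

lemma openin_skorokhod:
  "openin skorokhod_topology U \<longleftrightarrow>
     U \<subseteq> cadlag_paths \<and> (\<forall>x\<in>U. \<exists>T>0. \<exists>\<epsilon>>0. skorokhod_nbhd x T \<epsilon> \<subseteq> U)"
proof -
  have "istopology (\<lambda>U::(real \<Rightarrow> 'a) set. U \<subseteq> cadlag_paths \<and>
     (\<forall>x\<in>U. \<exists>T>0. \<exists>\<epsilon>>0. skorokhod_nbhd x T \<epsilon> \<subseteq> U))"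
    unfolding istopology_def
  proof (intro conjI allI impI; (elim conjE)?)
    fix S S' :: "(real \<Rightarrow> 'a) set"
    assume S: "S \<subseteq> cadlag_paths" "\<forall>x\<in>S. \<exists>T>0. \<exists>\<epsilon>>0. skorokhod_nbhd x T \<epsilon> \<subseteq> S"
      and S': "\<forall>x\<in>S'. \<exists>T>0. \<exists>\<epsilon>>0. skorokhod_nbhd x T \<epsilon> \<subseteq> S'"
    show "S \<inter> S' \<subseteq> cadlag_paths" using S(1) by blast
    show "\<forall>x\<in>S \<inter> S'. \<exists>T>0. \<exists>\<epsilon>>0. skorokhod_nbhd x T \<epsilon> \<subseteq> S \<inter> S'"
    proof
      fix x assume "x \<in> S \<inter> S'"
      then obtain T \<epsilon> T' \<epsilon>' where *: "T > 0" "\<epsilon> > 0" "skorokhod_nbhd x T \<epsilon> \<subseteq> S"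
        "T' > 0" "\<epsilon>' > 0" "skorokhod_nbhd x T' \<epsilon>' \<subseteq> S'"
        using S(2) S' by (meson IntE)
      have "skorokhod_nbhd x (max T T') (min \<epsilon> \<epsilon>') \<subseteq> S \<inter> S'"
        using skorokhod_nbhd_mono[of T "max T T'" "min \<epsilon> \<epsilon>'" \<epsilon> x]
          skorokhod_nbhd_mono[of T' "max T T'" "min \<epsilon> \<epsilon>'" \<epsilon>' x] *(3,6) by auto
      then show "\<exists>T>0. \<exists>\<epsilon>>0. skorokhod_nbhd x T \<epsilon> \<subseteq> S \<inter> S'"
        using *(1,2,5) by (meson less_max_iff_disj min_less_iff_conj)
    qed
  next
    fix K :: "(real \<Rightarrow> 'a) set set"
    assume K: "\<forall>S\<in>K. S \<subseteq> cadlag_paths \<and> (\<forall>x\<in>S. \<exists>T>0. \<exists>\<epsilon>>0. skorokhod_nbhd x T \<epsilon> \<subseteq> S)"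
    then show "\<Union>K \<subseteq> cadlag_paths" by blast
    show "\<forall>x\<in>\<Union>K. \<exists>T>0. \<exists>\<epsilon>>0. skorokhod_nbhd x T \<epsilon> \<subseteq> \<Union>K"
    proof
      fix x assume "x \<in> \<Union>K"
      then obtain S where "S \<in> K" "x \<in> S" by blast
      then obtain T \<epsilon> where "T > 0" "\<epsilon> > 0" "skorokhod_nbhd x T \<epsilon> \<subseteq> S"
        using K by blast
      with \<open>S \<in> K\<close> show "\<exists>T>0. \<exists>\<epsilon>>0. skorokhod_nbhd x T \<epsilon> \<subseteq> \<Union>K"
        by (meson Sup_upper subset_trans)
    qed
  qed
  then show ?thesis
    unfolding skorokhod_topology_def by (simp add: topology_inverse')
qed

lemma topspace_skorokhod: "topspace skorokhod_topology = cadlag_paths"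
proof
  show "topspace skorokhod_topology \<subseteq> (cadlag_paths :: (real \<Rightarrow> 'a) set)"
    using openin_skorokhod openin_topspace by blast
  have "openin skorokhod_topology (cadlag_paths :: (real \<Rightarrow> 'a) set)"
    unfolding openin_skorokhod skorokhod_nbhd_def
    by (auto intro!: exI[of _ 1])
  then show "(cadlag_paths :: (real \<Rightarrow> 'a) set) \<subseteq> topspace skorokhod_topology"
    by (rule openin_subset)
qed


section \<open>Weak convergence of random elements of a topological space\<close>

definition borel_of :: "'a topology \<Rightarrow> 'a measure" where
  "borel_of T = sigma (topspace T) {U. openin T U}"

definition converges_weakly ::
    "'a topology \<Rightarrow> 'w measure \<Rightarrow> (nat \<Rightarrow> 'w \<Rightarrow> 'a) \<Rightarrow> 'v measure \<Rightarrow> ('v \<Rightarrow> 'a) \<Rightarrow> bool" where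
  "converges_weakly T M Y N Z \<longleftrightarrow>
     (\<forall>n. Y n \<in> M \<rightarrow>\<^sub>M borel_of T) \<and> Z \<in> N \<rightarrow>\<^sub>M borel_of T \<and>
     (\<forall>f. continuous_map T euclideanreal f \<and> bounded (f ` topspace T) \<longrightarrow>
        (\<lambda>n. \<integral>\<omega>. f (Y n \<omega>) \<partial>M) \<longlonglongrightarrow> (\<integral>\<omega>. f (Z \<omega>) \<partial>N))"


section \<open>Asynchronous momentum SGD for streaming PCA\<close>

definition outer :: "real^'n \<Rightarrow> real^'m \<Rightarrow> real^'m^'n" where
  "outer x y = (\<chi> i j. x $ i * y $ j)"

definition pos_def :: "real^'n^'n \<Rightarrow> bool" where
  "pos_def A \<longleftrightarrow> transpose A = A \<and> (\<forall>x. x \<noteq> 0 \<longrightarrow> x \<bullet> (A *v x) > 0)"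

text \<open>\<open>lam 1, \<dots>, lam d\<close> are the eigenvalues of \<open>A\<close> with multiplicity, i.e. the roots of the
  characteristic polynomial.\<close>

definition eigenvalues :: "real^'n^'n \<Rightarrow> (nat \<Rightarrow> real) \<Rightarrow> bool" where
  "eigenvalues A lam \<longleftrightarrow> (\<forall>x. det (mat x - A) = (\<Prod>i=1..CARD('n). x - lam i))"

text \<open>\<open>\<tau> \<eta> k\<close> is of the same order as \<open>g \<eta>\<close> as \<open>\<eta> \<rightarrow> 0\<close>, uniformly in the step \<open>k > 0\<close>.\<close>

definition same_order :: "(real \<Rightarrow> nat \<Rightarrow> nat) \<Rightarrow> (real \<Rightarrow> real) \<Rightarrow> bool" where
  "same_order \<tau> g \<longleftrightarrow> (\<exists>c>0. \<exists>C>0. \<forall>\<^sub>F \<eta> in at_right 0. \<forall>k>0.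
     c * g \<eta> \<le> real (\<tau> \<eta> k) \<and> real (\<tau> \<eta> k) \<le> C * g \<eta>)"

text \<open>Realisation of the iterates for a data stream \<open>x\<^sub>1, x\<^sub>2, \<dots>\<close>.  The iterates carry
  integer indices, as a delay may point before time 0.\<close>

definition async_msgd ::
    "real \<Rightarrow> real \<Rightarrow> (nat \<Rightarrow> nat) \<Rightarrow> (nat \<Rightarrow> real^'n) \<Rightarrow> real^'n \<Rightarrow> (int \<Rightarrow> real^'n) \<Rightarrow> bool" where
  "async_msgd \<mu> \<eta> \<tau> x v0 v \<longleftrightarrow>
     (\<forall>i\<le>1. v i = v0) \<and>
     (\<forall>k>0. v (int k + 1) = v (int k) + \<mu> *\<^sub>R (v (int k) - v (int k - 1)) +
        \<eta> *\<^sub>R (((mat 1 - outer (v (int k - int (\<tau> k))) (v (int k - int (\<tau> k)))) ** outer (x k) (x k))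
                *v v (int k - int (\<tau> k))))"

definition interpolation :: "real \<Rightarrow> (int \<Rightarrow> real^'n) \<Rightarrow> real \<Rightarrow> real^'n" where
  "interpolation \<eta> v = (\<lambda>t\<in>{0..}. v \<lfloor>t / \<eta>\<rfloor>)"

definition solves_limit_ode :: "real \<Rightarrow> real^'n^'n \<Rightarrow> real^'n \<Rightarrow> (real \<Rightarrow> real^'n) \<Rightarrow> bool" where
  "solves_limit_ode \<mu> \<Sigma> v0 V \<longleftrightarrow> V 0 = v0 \<and>
     (\<forall>t\<ge>0. (V has_vector_derivative
        (1 / (1 - \<mu>)) *\<^sub>R (\<Sigma> *v V t - (V t \<bullet> (\<Sigma> *v V t)) *\<^sub>R V t)) (at t within {0..}))"

end

theory Submission
  imports Defs
begin

text \<open>The limit is deterministic, and almost every realisation converges.  With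
  \<open>z\<^sub>k = v\<^sub>k + (\<mu> / (1 - \<mu>)) (v\<^sub>k - v\<^sub>k\<^sub>-\<^sub>1)\<close> the momentum disappears: \<open>z\<close> moves by \<open>\<eta> / (1 - \<mu>)\<close> times the
  stochastic gradient, and \<open>z - v\<close> is of order \<open>\<eta>\<close>.  As long as the iterates stay in a ball, one step
  has size \<open>O(\<eta>)\<close>, so the delay costs \<open>O(\<eta>\<tau>) = O(\<eta> powr \<gamma>)\<close>.  The noise
  \<open>x\<^sub>k x\<^sub>k\<^sup>T - \<Sigma>\<close> enters linearly against the slowly varying \<open>v\<^sub>k\<close>; summation by parts bounds its
  contribution by the largest \<open>\<eta>\<close>-multiple of its partial sums up to time \<open>T / \<eta>\<close>, which tends to 0
  by the strong law of large numbers.  Gronwall's inequality then compares \<open>z\<close> with the solution of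
  the ODE, which stays on the unit sphere and so keeps the iterates in the ball.  Uniform
  convergence on compacts gives convergence in the Skorokhod topology, and dominated convergence
  gives weak convergence.\<close>


section \<open>Momentum iterations with delays\<close>

text \<open>The majorant \<open>E + q * sum\<close> itself grows by at most the factor
  \<open>1 + q\<close> per step; \<open>1 + q \<le> exp q\<close> then turns the power into an
  exponential.\<close>

lemma discrete_gronwall:
  fixes a :: "nat \<Rightarrow> real"
  assumes step: "\<And>k. 1 \<le> k \<Longrightarrow> k \<le> n \<Longrightarrow> a k \<le> E + q * (\<Sum>j=1..<k. a j)"
    and "0 \<le> q" "0 \<le> E" and "1 \<le> k" "k \<le> n"
  shows "a k \<le> E * exp (q * real k)"
proof -
  have "1 \<le> k \<Longrightarrow> k \<le> n \<Longrightarrow> E + q * (\<Sum>j=1..<k. a j) \<le> E * (1 + q) ^ k" for k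
  proof (induction k)
    case (Suc k)
    show ?case
    proof (cases "k = 0")
      case True
      then show ?thesis using \<open>0 \<le> q\<close> \<open>0 \<le> E\<close> by (simp add: algebra_simps)
    next
      case False
      then have k: "1 \<le> k" "k \<le> n" using Suc.prems by auto
      have "E + q * (\<Sum>j=1..<Suc k. a j) = E + q * (\<Sum>j=1..<k. a j) + q * a k"
        using k by (simp add: algebra_simps)
      also have "\<dots> \<le> (E + q * (\<Sum>j=1..<k. a j)) * (1 + q)"
        using mult_left_mono[OF step[OF k] \<open>0 \<le> q\<close>] by (simp add: algebra_simps)
      also have "\<dots> \<le> E * (1 + q) ^ k * (1 + q)"
        using Suc.IH[OF k] \<open>0 \<le> q\<close> by (intro mult_right_mono) auto
      finally show ?thesis by (simp add: algebra_simps)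
    qed
  qed simp
  then have "a k \<le> E * (1 + q) ^ k"
    using step[of k] assms(4,5) by force
  also have "(1 + q) ^ k \<le> exp q ^ k"
    using \<open>0 \<le> q\<close> by (intro power_mono exp_ge_add_one_self) auto
  also have "exp q ^ k = exp (q * real k)"
    by (metis exp_of_nat2_mult)
  finally show ?thesis
    using \<open>0 \<le> E\<close> by (simp add: mult_left_mono)
qed

text \<open>Abel summation with additive maps \<open>f j\<close> as weights, because the weight will
  be \<open>\<lambda>M. F M (v j)\<close> and not a scalar. Additivity is stated through
  differences, which also gives \<open>f j 0 = 0\<close>.\<close>

lemma summation_by_parts:
  fixes f :: "nat \<Rightarrow> 'b::ab_group_add \<Rightarrow> 'a::ab_group_add"
  assumes diff: "\<And>j x y. f j (x - y) = f j x - f j y" and zero: "S 0 = 0"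
  shows "(\<Sum>j=1..<Suc m. f j (S j - S (j - 1)))
    = f m (S m) - (\<Sum>j=1..<m. f (Suc j) (S j) - f j (S j))"
proof (induction m)
  case 0
  have "f 0 0 = 0" using diff[of 0 0 0] by simp
  then show ?case by (simp add: zero)
next
  case (Suc m)
  have "f 1 0 = 0" using diff[of 1 0 0] by simp
  moreover have "f 0 0 = 0" using diff[of 0 0 0] by simp
  ultimately show ?case using Suc zero
    by (cases "m = 0") (auto simp: diff)
qed

text \<open>One realisation of the iteration, with the randomness frozen: \<open>A k\<close> stands
  for the observed matrix and \<open>Abar\<close> for its mean. Oja's field is cubic in the state,
  so growth and Lipschitz bounds are asked only on the ball of radius \<open>R\<close>; that the
  iterates stay there has to be proved.\<close>

locale delayed_momentum =
  fixes F :: "'b::real_normed_vector \<Rightarrow> 'a::real_normed_vector \<Rightarrow> 'a"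
    and R B L a :: real
    and A :: "nat \<Rightarrow> 'b" and Abar :: 'b
    and \<mu> \<eta> :: real and \<tau> :: "nat \<Rightarrow> nat"
    and v0 :: 'a and v :: "int \<Rightarrow> 'a"
  assumes linear_F: "linear (\<lambda>M. F M x)"
    and F_bound: "norm x \<le> R \<Longrightarrow> norm (F M x) \<le> B * norm M"
    and F_lipschitz: "norm x \<le> R \<Longrightarrow> norm y \<le> R \<Longrightarrow>
          norm (F M x - F M y) \<le> L * norm M * norm (x - y)"
    and B_nonneg: "0 \<le> B" and L_nonneg: "0 \<le> L"
    and A_bound: "1 \<le> k \<Longrightarrow> norm (A k) \<le> a" and Abar_bound: "norm Abar \<le> a"
    and mu: "0 \<le> \<mu>" "\<mu> < 1" and eta_pos: "0 < \<eta>"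
    and v_init: "i \<le> 1 \<Longrightarrow> v i = v0"
    and v_step: "1 \<le> k \<Longrightarrow> v (int k + 1) = v (int k) + \<mu> *\<^sub>R (v (int k) - v (int k - 1))
          + \<eta> *\<^sub>R F (A k) (v (int k - int (\<tau> k)))"
begin

definition c where "c = 1 / (1 - \<mu>)"

definition speed where "speed = c * B * a"

definition noise where "noise k = (\<Sum>j=1..k. A j - Abar)"

text \<open>Chosen so that \<open>z (Suc k) - z k\<close> contains no momentum term.\<close>

definition z where "z k = v (int k) + (\<mu> * c) *\<^sub>R (v (int k) - v (int k - 1))"

lemma a_nonneg: "0 \<le> a"
  using Abar_bound norm_ge_zero[of Abar] by linarith

lemma c_ge_1: "1 \<le> c" and c_identity: "1 + \<mu> * c = c"
  using mu unfolding c_def by (auto simp: field_simps)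

lemma speed_nonneg: "0 \<le> speed"
  unfolding speed_def using c_ge_1 B_nonneg a_nonneg by simp

lemma z_1: "z 1 = v0"
  using v_init[of 0] v_init[of 1] by (simp add: z_def)

text \<open>By \<open>1 + \<mu> * c = c\<close>, the new \<open>z\<close> is
  \<open>v k + c * (v (k + 1) - v k)\<close>; inserting the recursion, its momentum part
  \<open>c * \<mu> * (v k - v (k - 1))\<close> is exactly \<open>z k - v k\<close>.\<close>

lemma z_step:
  assumes "1 \<le> k"
  shows "z (Suc k) = z k + (\<eta> * c) *\<^sub>R F (A k) (v (int k - int (\<tau> k)))"
proof -
  have "z (Suc k) = v (int k + 1) + (\<mu> * c) *\<^sub>R (v (int k + 1) - v (int k))"
    unfolding z_def by (simp add: add.commute)
  also have "\<dots> = v (int k) + c *\<^sub>R (v (int k + 1) - v (int k))"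
    by (subst (2) c_identity[symmetric]) (simp add: algebra_simps)
  also have "\<dots> = v (int k) + c *\<^sub>R (\<mu> *\<^sub>R (v (int k) - v (int k - 1))
      + \<eta> *\<^sub>R F (A k) (v (int k - int (\<tau> k))))"
    using v_step[OF assms] by simp
  finally show ?thesis unfolding z_def by (simp add: algebra_simps)
qed

text \<open>The ball is assumed only for indices strictly below \<open>k\<close>, yet the bounds
  below reach \<open>v k\<close> itself. This gap of one step is what lets the induction in
  \<open>tracking\<close> close.\<close>

context
  fixes k :: nat
  assumes bounded_past: "\<And>i. i < int k \<Longrightarrow> norm (v i) \<le> R"
begin

lemma gradient_bound:
  assumes "1 \<le> j" "j < k"
  shows "norm (F (A j) (v (int j - int (\<tau> j)))) \<le> B * a"
proof -
  have "norm (F (A j) (v (int j - int (\<tau> j)))) \<le> B * norm (A j)"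
    using assms by (intro F_bound bounded_past) auto
  also have "\<dots> \<le> B * a" using A_bound assms B_nonneg by (simp add: mult_left_mono)
  finally show ?thesis .
qed

text \<open>At worst the increments obey \<open>d \<mapsto> \<mu> * d + \<eta> * B * a\<close>,
  whose fixed point is \<open>\<eta> * speed\<close>; they start at 0 because
  \<open>v 0 = v 1\<close>.\<close>

lemma increment_bound: "j < k \<Longrightarrow> norm (v (int j + 1) - v (int j)) \<le> \<eta> * speed"
proof (induction j)
  case 0
  then show ?case using v_init[of 0] v_init[of 1] speed_nonneg eta_pos by simp
next
  case (Suc j)
  have "norm (v (int (Suc j) + 1) - v (int (Suc j)))
      = norm (\<mu> *\<^sub>R (v (int j + 1) - v (int j))
          + \<eta> *\<^sub>R F (A (Suc j)) (v (int (Suc j) - int (\<tau> (Suc j)))))"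
    using v_step[of "Suc j"] by (simp add: add.commute)
  also have "\<dots> \<le> \<mu> * norm (v (int j + 1) - v (int j))
      + \<eta> * norm (F (A (Suc j)) (v (int (Suc j) - int (\<tau> (Suc j)))))"
    by (rule order_trans[OF norm_triangle_ineq]) (use mu eta_pos in simp)
  also have "\<dots> \<le> \<mu> * (\<eta> * speed) + \<eta> * (B * a)"
    using Suc gradient_bound[of "Suc j"] mu eta_pos by (intro add_mono mult_left_mono) auto
  also have "\<dots> = \<eta> * ((\<mu> * c + 1) * (B * a))"
    by (simp add: speed_def algebra_simps)
  also have "\<dots> = \<eta> * speed"
    using c_identity by (simp add: speed_def add.commute mult.assoc)
  finally show ?case .
qed

lemma increment_bound_int:
  assumes "i < int k" shows "norm (v (i + 1) - v i) \<le> \<eta> * speed"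
proof (cases "i \<ge> 0")
  case True
  then show ?thesis using increment_bound[of "nat i"] assms by simp
next
  case False
  then show ?thesis using v_init[of i] v_init[of "i + 1"] speed_nonneg eta_pos by simp
qed

text \<open>Telescoping over \<open>m\<close> increments; with \<open>m = \<tau> j\<close> this is
  the price of a stale gradient. Indices before time 0 are harmless since \<open>v\<close> is
  constant there.\<close>

lemma delay_bound:
  assumes "j \<le> int k"
  shows "norm (v j - v (j - int m)) \<le> real m * (\<eta> * speed)"
proof (induction m)
  case (Suc m)
  have "norm (v j - v (j - int (Suc m))) \<le> norm (v j - v (j - int m))
      + norm (v (j - int (Suc m) + 1) - v (j - int (Suc m)))"
    by (rule order_trans[OF _ norm_triangle_ineq]) (simp add: algebra_simps)
  also have "\<dots> \<le> real m * (\<eta> * speed) + \<eta> * speed"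
    using assms by (intro add_mono Suc increment_bound_int) auto
  finally show ?case by (simp add: algebra_simps)
qed simp

lemma momentum_bound:
  assumes "1 \<le> j" "j \<le> k"
  shows "norm (z j - v (int j)) \<le> c * \<eta> * speed"
proof -
  have "norm (z j - v (int j)) = \<mu> * c * norm (v (int j) - v (int j - 1))"
    unfolding z_def using mu c_ge_1 by simp
  also have "\<dots> \<le> \<mu> * c * (\<eta> * speed)"
    using increment_bound_int[of "int j - 1"] assms mu c_ge_1
    by (intro mult_left_mono) auto
  also have "\<dots> \<le> c * (\<eta> * speed)"
    using mu c_ge_1 speed_nonneg eta_pos by (intro mult_right_mono) auto
  finally show ?thesis by simp
qed

text \<open>In the factor, \<open>B\<close> comes from the boundary term of the summation by parts
  and \<open>L * T * speed\<close> from the variation of \<open>v\<close>: at most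
  \<open>T / \<eta>\<close> increments of size \<open>\<eta> * speed\<close>.\<close>

lemma noise_sum_bound:
  assumes "1 \<le> m" "m < k" and noise: "\<And>j. j < k \<Longrightarrow> \<eta> * norm (noise j) \<le> \<sigma>"
    and T: "\<eta> * real k \<le> T"
  shows "\<eta> * norm (\<Sum>j=1..<Suc m. F (A j - Abar) (v (int j))) \<le> (B + L * T * speed) * \<sigma>"
proof -
  have diff: "F (x - y) w = F x w - F y w" for x y w
    using linear_diff[OF linear_F] .
  have incr: "A j - Abar = noise j - noise (j - 1)" if "1 \<le> j" for j
    using that by (cases j) (auto simp: noise_def)
  have \<sigma>: "0 \<le> \<sigma>" using noise[of 0] assms(1,2) by (simp add: noise_def)
  \<comment> \<open>Summing by parts moves the differences from the noise to \<open>v\<close>, whose increments are \<open>O(\<eta>)\<close>.\<close>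
  have "(\<Sum>j=1..<Suc m. F (A j - Abar) (v (int j)))
      = (\<Sum>j=1..<Suc m. F (noise j - noise (j - 1)) (v (int j)))"
    by (rule sum.cong) (auto simp: incr)
  also have "\<dots> = F (noise m) (v (int m))
      - (\<Sum>j=1..<m. F (noise j) (v (int (Suc j))) - F (noise j) (v (int j)))"
    using summation_by_parts[where f = "\<lambda>j M. F M (v (int j))" and S = noise and m = m] diff
    by (simp add: noise_def)
  finally have "\<eta> * norm (\<Sum>j=1..<Suc m. F (A j - Abar) (v (int j)))
      \<le> \<eta> * (norm (F (noise m) (v (int m)))
        + (\<Sum>j=1..<m. norm (F (noise j) (v (int (Suc j))) - F (noise j) (v (int j)))))"
    using eta_pos by (auto intro!: order_trans[OF norm_triangle_ineq4] add_mono norm_sum)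
  also have "\<dots> \<le> \<eta> * (B * norm (noise m) + (\<Sum>j=1..<m. L * norm (noise j) * (\<eta> * speed)))"
  proof (intro mult_left_mono add_mono sum_mono)
    show "norm (F (noise m) (v (int m))) \<le> B * norm (noise m)"
      using assms by (intro F_bound bounded_past) auto
    fix j assume j: "j \<in> {1..<m}"
    have "norm (F (noise j) (v (int (Suc j))) - F (noise j) (v (int j)))
        \<le> L * norm (noise j) * norm (v (int (Suc j)) - v (int j))"
      using j assms by (intro F_lipschitz bounded_past) auto
    also have "\<dots> \<le> L * norm (noise j) * (\<eta> * speed)"
      using increment_bound[of j] j assms L_nonneg
      by (intro mult_left_mono) (auto simp: add.commute)
    finally show "norm (F (noise j) (v (int (Suc j))) - F (noise j) (v (int j)))
        \<le> L * norm (noise j) * (\<eta> * speed)" .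
  qed (use eta_pos in auto)
  also have "\<dots> = B * (\<eta> * norm (noise m))
      + (\<Sum>j=1..<m. L * (\<eta> * norm (noise j)) * (\<eta> * speed))"
    by (simp add: algebra_simps sum_distrib_left)
  also have "\<dots> \<le> B * \<sigma> + (\<Sum>j=1..<m. L * \<sigma> * (\<eta> * speed))"
    using noise assms(1,2) B_nonneg L_nonneg eta_pos speed_nonneg
    by (intro add_mono sum_mono mult_left_mono mult_right_mono) auto
  also have "(\<Sum>j=1..<m. L * \<sigma> * (\<eta> * speed)) = (\<eta> * real (m - 1)) * (L * \<sigma> * speed)"
    by simp
  also have "\<dots> \<le> T * (L * \<sigma> * speed)"
  proof (intro mult_right_mono)
    have "\<eta> * real (m - 1) \<le> \<eta> * real k" using assms(1,2) eta_pos by simp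
    then show "\<eta> * real (m - 1) \<le> T" using T by linarith
  qed (use L_nonneg \<sigma> speed_nonneg in auto)
  finally show ?thesis by (simp add: algebra_simps)
qed

end

text \<open>Here \<open>u\<close> is any sequence following the averaged Euler scheme with step
  \<open>\<eta> * c\<close> up to a defect of order \<open>\<eta>\<close> squared. In the bound,
  \<open>Q\<close> measures that defect, \<open>\<theta>\<close> the delay and
  \<open>\<sigma>\<close> the noise. The third summand pays for replacing \<open>v\<close> by
  \<open>z\<close> in the drift, the one outside the exponential for returning from \<open>z\<close>
  to \<open>v\<close>.\<close>

lemma error_bound:
  assumes past: "\<And>i. i < int k \<Longrightarrow> norm (v i) \<le> R" and "1 \<le> k"
    and T: "\<eta> * real k \<le> T"
    and noise: "\<And>j. j < k \<Longrightarrow> \<eta> * norm (noise j) \<le> \<sigma>"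
    and delay: "\<And>j. 1 \<le> j \<Longrightarrow> \<eta> * real (\<tau> j) \<le> \<theta>"
    and u_1: "u 1 = v0"
    and u_bound: "\<And>j. 1 \<le> j \<Longrightarrow> norm (u j) \<le> R"
    and u_step: "\<And>j. 1 \<le> j \<Longrightarrow> norm (u (Suc j) - u j - (\<eta> * c) *\<^sub>R F Abar (u j)) \<le> Q * \<eta>\<^sup>2"
  shows "norm (v (int k) - u k) \<le>
    (Q * T * \<eta> + c * T * L * a * speed * \<theta> + c * T * L * a * c * speed * \<eta>
      + c * (B + L * T * speed) * \<sigma>) * exp (c * L * a * T) + c * speed * \<eta>"
proof -
  define E where "E = Q * T * \<eta> + c * T * L * a * speed * \<theta> + c * T * L * a * c * speed * \<eta>
      + c * (B + L * T * speed) * \<sigma>"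
  define e where "e j = z j - u j" for j
  \<comment> \<open>Delay, noise and distance to \<open>u\<close>: the sum
    \<open>g1 j + g2 j + g3 j\<close> telescopes to the delayed gradient minus
    \<open>F Abar (u j)\<close>.\<close>
  define g1 where "g1 j = F (A j) (v (int j - int (\<tau> j))) - F (A j) (v (int j))" for j
  define g2 where "g2 j = F (A j - Abar) (v (int j))" for j
  define g3 where "g3 j = F Abar (v (int j)) - F Abar (u j)" for j
  define r where "r j = u (Suc j) - u j - (\<eta> * c) *\<^sub>R F Abar (u j)" for j
  have T0: "0 \<le> T" using eta_pos by (intro order_trans[OF _ T]) simp
  have \<theta>0: "0 \<le> \<theta>" using eta_pos by (intro order_trans[OF _ delay[of 1]]) simp_all
  have \<sigma>0: "0 \<le> \<sigma>" using noise[of 0] \<open>1 \<le> k\<close> by (simp add: noise_def)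
  have "0 \<le> Q * \<eta>\<^sup>2"
    by (rule order_trans[OF norm_ge_zero u_step[of 1]]) simp
  then have Q0: "0 \<le> Q"
    using eta_pos by (simp add: zero_le_mult_iff)
  have E0: "0 \<le> E" unfolding E_def
    using T0 \<theta>0 \<sigma>0 Q0 c_ge_1 L_nonneg B_nonneg a_nonneg speed_nonneg eta_pos by simp
  have diff: "F (x - y) w = F x w - F y w" for x y w
    using linear_diff[OF linear_F] .
  have e_step: "e (Suc j) = e j + ((\<eta> * c) *\<^sub>R (g1 j + g2 j + g3 j) - r j)" if "1 \<le> j" for j
    unfolding e_def g1_def g2_def g3_def r_def z_step[OF that] diff
    by (simp add: algebra_simps)
  have e_sum: "e (Suc m) = (\<Sum>j=1..<Suc m. (\<eta> * c) *\<^sub>R (g1 j + g2 j + g3 j) - r j)" for m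
  proof (induction m)
    case 0
    then show ?case using z_1 u_1 by (simp add: e_def)
  next
    case (Suc m)
    show ?case using e_step[of "Suc m"] Suc by simp
  qed
  have ek: "norm (e m) \<le> E + (\<eta> * c * L * a) * (\<Sum>j=1..<m. norm (e j))"
    if m: "1 \<le> m" "m \<le> k" for m
  proof (cases "m = 1")
    case True
    then show ?thesis using E0 z_1 u_1 by (simp add: e_def)
  next
    case False
    then obtain p where p: "m = Suc p" "1 \<le> p" "p < k" using m by (cases m) auto
    have b1: "norm (g1 j) \<le> L * a * (\<theta> * speed)" if "j \<in> {1..<m}" for j
    proof -
      have "norm (g1 j) \<le> L * norm (A j) * norm (v (int j - int (\<tau> j)) - v (int j))"
        unfolding g1_def using that m by (intro F_lipschitz past) auto
      also have "\<dots> \<le> L * a * (real (\<tau> j) * (\<eta> * speed))"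
        using delay_bound[OF past, of k "int j" "\<tau> j"] that m A_bound L_nonneg a_nonneg
        by (intro mult_mono) (auto simp: norm_minus_commute)
      also have "\<dots> = L * a * ((\<eta> * real (\<tau> j)) * speed)" by simp
      also have "\<dots> \<le> L * a * (\<theta> * speed)"
        using delay[of j] that L_nonneg a_nonneg speed_nonneg
        by (intro mult_left_mono mult_right_mono) auto
      finally show ?thesis .
    qed
    \<comment> \<open>The distance from \<open>v\<close> to \<open>u\<close> is expressed through
      \<open>e\<close>, so that Gronwall's inequality applies to \<open>e\<close> alone.\<close>
    have b3: "norm (g3 j) \<le> L * a * (norm (e j) + c * \<eta> * speed)" if "j \<in> {1..<m}" for j
    proof -
      have "norm (v (int j) - u j) \<le> norm (e j) + norm (z j - v (int j))"
        unfolding e_def by (rule order_trans[OF _ norm_triangle_ineq4]) simp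
      also have "\<dots> \<le> norm (e j) + c * \<eta> * speed"
        using momentum_bound[OF past, of k j] that m by auto
      finally have *: "norm (v (int j) - u j) \<le> norm (e j) + c * \<eta> * speed" .
      have "norm (g3 j) \<le> L * norm Abar * norm (v (int j) - u j)"
        unfolding g3_def using that m by (intro F_lipschitz past u_bound) auto
      also have "\<dots> \<le> L * a * (norm (e j) + c * \<eta> * speed)"
        using * Abar_bound L_nonneg a_nonneg by (intro mult_mono) auto
      finally show ?thesis .
    qed
    have "norm (e m) = norm ((\<eta> * c) *\<^sub>R ((\<Sum>j=1..<m. g1 j) + (\<Sum>j=1..<m. g2 j) + (\<Sum>j=1..<m. g3 j))
        - (\<Sum>j=1..<m. r j))"
      unfolding p(1) e_sum by (simp add: sum_subtractf scaleR_sum_right sum.distrib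
          scaleR_add_right del: sum.op_ivl_Suc)
    also have "\<dots> \<le> (\<eta> * c) * (norm (\<Sum>j=1..<m. g1 j) + norm (\<Sum>j=1..<m. g2 j)
        + norm (\<Sum>j=1..<m. g3 j)) + norm (\<Sum>j=1..<m. r j)"
      using eta_pos c_ge_1
      by (intro order_trans[OF norm_triangle_ineq4] add_mono)
        (auto intro!: order_trans[OF norm_triangle_ineq] add_mono)
    also have "\<dots> \<le> (\<eta> * c) * ((\<Sum>j=1..<m. L * a * (\<theta> * speed)) + norm (\<Sum>j=1..<m. g2 j)
        + (\<Sum>j=1..<m. L * a * (norm (e j) + c * \<eta> * speed))) + (\<Sum>j=1..<m. Q * \<eta>\<^sup>2)"
      using eta_pos c_ge_1 b1 b3 u_step
      by (intro add_mono mult_left_mono sum_norm_le) (auto simp: r_def)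
    \<comment> \<open>The number \<open>m - 1\<close> of summands is always paired with one factor
      \<open>\<eta>\<close>, since \<open>\<eta> * (m - 1) \<le> T\<close>.\<close>
    also have "\<dots> = c * ((\<eta> * real (m - 1)) * (L * a * \<theta> * speed)) + c * (\<eta> * norm (\<Sum>j=1..<m. g2 j))
        + (\<eta> * c * L * a) * (\<Sum>j=1..<m. norm (e j))
        + c * L * a * c * \<eta> * speed * (\<eta> * real (m - 1)) + Q * \<eta> * (\<eta> * real (m - 1))"
      using p by (simp add: sum.distrib sum_distrib_left[symmetric] algebra_simps power2_eq_square)
    also have "\<dots> \<le> c * (T * (L * a * \<theta> * speed)) + c * ((B + L * T * speed) * \<sigma>)
        + (\<eta> * c * L * a) * (\<Sum>j=1..<m. norm (e j))
        + c * L * a * c * \<eta> * speed * T + Q * \<eta> * T"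
    proof -
      have "\<eta> * real (m - 1) \<le> \<eta> * real k" using m eta_pos by simp
      then have 1: "\<eta> * real (m - 1) \<le> T" using T by linarith
      have 2: "\<eta> * norm (\<Sum>j=1..<m. g2 j) \<le> (B + L * T * speed) * \<sigma>"
        unfolding g2_def p(1) by (rule noise_sum_bound[OF past p(2,3) noise T])
      show ?thesis
        using 1 2 c_ge_1 L_nonneg a_nonneg \<theta>0 speed_nonneg Q0 eta_pos
        by (intro add_mono mult_left_mono mult_right_mono order_refl mult_nonneg_nonneg) auto
    qed
    also have "\<dots> = E + (\<eta> * c * L * a) * (\<Sum>j=1..<m. norm (e j))"
      unfolding E_def by (simp add: algebra_simps)
    finally show ?thesis .
  qed
  have q0: "0 \<le> \<eta> * c * L * a" using eta_pos c_ge_1 L_nonneg a_nonneg by simp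
  have "norm (e k) \<le> E * exp ((\<eta> * c * L * a) * real k)"
    using discrete_gronwall[of k "\<lambda>j. norm (e j)", OF ek q0 E0 \<open>1 \<le> k\<close>] by simp
  also have "(\<eta> * c * L * a) * real k = c * L * a * (\<eta> * real k)" by simp
  also have "E * exp (c * L * a * (\<eta> * real k)) \<le> E * exp (c * L * a * T)"
    using E0 T c_ge_1 L_nonneg a_nonneg by (intro mult_left_mono) (auto intro!: mult_left_mono)
  finally have "norm (e k) \<le> E * exp (c * L * a * T)" .
  moreover have "norm (v (int k) - u k) \<le> norm (e k) + norm (z k - v (int k))"
    unfolding e_def by (rule order_trans[OF _ norm_triangle_ineq4]) simp
  moreover have "norm (z k - v (int k)) \<le> c * \<eta> * speed"
    using momentum_bound[OF past \<open>1 \<le> k\<close>] by simp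
  ultimately show ?thesis unfolding E_def by (simp add: algebra_simps)
qed

end

context delayed_momentum begin

text \<open>The closeness of \<open>v\<close> to \<open>u\<close> up to step \<open>k - 1\<close> keeps the past in the ball of radius \<open>R\<close>, where
  the growth and Lipschitz bounds on \<open>F\<close> yield the closeness at step \<open>k\<close>.\<close>

lemma tracking:
  assumes T: "\<eta> * real K \<le> T"
    and noise: "\<And>j. j \<le> K \<Longrightarrow> \<eta> * norm (noise j) \<le> \<sigma>"
    and delay: "\<And>j. 1 \<le> j \<Longrightarrow> \<eta> * real (\<tau> j) \<le> \<theta>"
    and u_1: "u 1 = v0"
    and u_bound: "\<And>j. 1 \<le> j \<Longrightarrow> norm (u j) \<le> R'"
    and u_step: "\<And>j. 1 \<le> j \<Longrightarrow> norm (u (Suc j) - u j - (\<eta> * c) *\<^sub>R F Abar (u j)) \<le> Q * \<eta>\<^sup>2"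
    and R': "R' \<le> R" "R' + \<rho> \<le> R"
    and \<rho>: "(Q * T * \<eta> + c * T * L * a * speed * \<theta> + c * T * L * a * c * speed * \<eta>
      + c * (B + L * T * speed) * \<sigma>) * exp (c * L * a * T) + c * speed * \<eta> \<le> \<rho>"
  shows "1 \<le> k \<Longrightarrow> k \<le> K \<Longrightarrow> norm (v (int k) - u k) \<le> \<rho>"
proof (induction k rule: less_induct)
  case (less k)
  have past: "norm (v i) \<le> R" if i: "i < int k" for i
  proof (cases "i \<le> 1")
    case True
    then show ?thesis using v_init[of i] u_1 u_bound[of 1] R' by simp
  next
    case False
    then obtain j where j: "i = int j" "1 \<le> j" "j < k"
      using i by (intro that[of "nat i"]) auto
    have "norm (v i) \<le> norm (v i - u j) + norm (u j)"
      by (rule order_trans[OF _ norm_triangle_ineq]) simp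
    also have "\<dots> \<le> \<rho> + R'"
      using less.IH[of j] less.prems j u_bound[of j] by (intro add_mono) auto
    finally show ?thesis using R' by simp
  qed
  have "\<eta> * real k \<le> \<eta> * real K" using less.prems eta_pos by simp
  then have Tk: "\<eta> * real k \<le> T" using T by linarith
  show ?case
    using error_bound[OF past less.prems(1) Tk _ delay u_1 _ u_step] noise less.prems
      u_bound R' \<rho> by (meson order.trans order_less_imp_le)
qed

end

section \<open>Comparison with the solution of a differential equation\<close>

lemma vector_derivative_lipschitz:
  fixes V :: "real \<Rightarrow> 'a::real_normed_vector"
  assumes deriv: "\<And>t. 0 \<le> t \<Longrightarrow> (V has_vector_derivative V' t) (at t within {0..})"
    and bound: "\<And>t. 0 \<le> t \<Longrightarrow> norm (V' t) \<le> G"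
    and "0 \<le> s" "0 \<le> t"
  shows "norm (V s - V t) \<le> G * \<bar>s - t\<bar>"
proof -
  have "norm (V s - V t) \<le> G * norm (s - t)"
  proof (rule differentiable_bound[of "{0..}"])
    show "onorm (\<lambda>h. h *\<^sub>R V' x) \<le> G" if "x \<in> {0..}" for x
      using bound[of x] that
      by (intro onorm_le) (auto simp: mult.commute[of G] intro!: mult_left_mono)
  qed (use assms in \<open>auto simp: has_vector_derivative_def\<close>)
  then show ?thesis by simp
qed

text \<open>During a time \<open>\<eta>\<close> the solution moves by at most
  \<open>G * \<eta>\<close>, hence its velocity changes by at most \<open>l * G * \<eta>\<close>;
  integrating over the step gives the square.\<close>

lemma euler_step_bound:
  fixes V :: "real \<Rightarrow> 'a::real_normed_vector"
  assumes deriv: "\<And>t. 0 \<le> t \<Longrightarrow> (V has_vector_derivative f (V t)) (at t within {0..})"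
    and bound: "\<And>t. 0 \<le> t \<Longrightarrow> norm (f (V t)) \<le> G"
    and lip: "\<And>s t. 0 \<le> s \<Longrightarrow> 0 \<le> t \<Longrightarrow> norm (f (V s) - f (V t)) \<le> l * norm (V s - V t)"
    and "0 \<le> l" "0 \<le> t" "0 \<le> \<eta>"
  shows "norm (V (t + \<eta>) - V t - \<eta> *\<^sub>R f (V t)) \<le> l * G * \<eta>\<^sup>2"
proof -
  have "norm (V (t + \<eta>) - V t - (t + \<eta> - t) *\<^sub>R f (V t)) \<le> norm (t + \<eta> - t) * (l * (G * \<eta>))"
  proof (rule vector_differentiable_bound_linearization[where S = "{t..t + \<eta>}" and f' = "\<lambda>s. f (V s)"])
    show "(V has_vector_derivative f (V s)) (at s within {t..t + \<eta>})" if "s \<in> {t..t + \<eta>}" for s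
      using that \<open>0 \<le> t\<close> by (intro has_vector_derivative_within_subset[OF deriv]) auto
    fix s assume s: "s \<in> {t..t + \<eta>}"
    have G: "0 \<le> G" using bound[of t] \<open>0 \<le> t\<close> norm_ge_zero order_trans by blast
    have "norm (f (V s) - f (V t)) \<le> l * norm (V s - V t)"
      using s \<open>0 \<le> t\<close> by (intro lip) auto
    also have "norm (V s - V t) \<le> G * \<bar>s - t\<bar>"
      using s \<open>0 \<le> t\<close> by (intro vector_derivative_lipschitz[OF deriv bound]) auto
    also have "\<dots> \<le> G * \<eta>" using s G by (intro mult_left_mono) auto
    finally show "norm (f (V s) - f (V t)) \<le> l * (G * \<eta>)"
      using \<open>0 \<le> l\<close> by (simp add: mult_left_mono)
  qed (use \<open>0 \<le> \<eta>\<close> in \<open>auto simp: closed_segment_eq_real_ivl\<close>)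
  then show ?thesis using \<open>0 \<le> \<eta>\<close> by (simp add: power2_eq_square algebra_simps)
qed

text \<open>Sublinear growth means \<open>norm (S j) \<le> \<epsilon> * j + M\<close> for all
  \<open>j\<close>. Multiplied by \<open>h n\<close>, the first term is at most
  \<open>\<epsilon> * T\<close> and the second vanishes, uniformly in \<open>j\<close>.\<close>

lemma scaled_partial_sums_small:
  fixes S :: "nat \<Rightarrow> 'b::real_normed_vector"
  assumes S: "(\<lambda>j. S j /\<^sub>R real j) \<longlonglongrightarrow> 0" and h: "h \<longlonglongrightarrow> (0::real)" "\<And>n. 0 < h n"
    and "0 \<le> T" "0 < \<sigma>"
  shows "\<forall>\<^sub>F n in sequentially. \<forall>j. h n * real j \<le> T \<longrightarrow> h n * norm (S j) \<le> \<sigma>"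
proof -
  \<comment> \<open>Half of \<open>\<sigma>\<close> for each of the two terms; the
    \<open>+ 1\<close> keeps the denominator positive when \<open>T = 0\<close>.\<close>
  define \<epsilon> where "\<epsilon> = \<sigma> / (2 * (T + 1))"
  have \<epsilon>: "0 < \<epsilon>" "\<epsilon> * T \<le> \<sigma> / 2"
    using \<open>0 \<le> T\<close> \<open>0 < \<sigma>\<close> by (auto simp: \<epsilon>_def field_simps)
  obtain J where J: "\<And>j. J \<le> j \<Longrightarrow> norm (S j /\<^sub>R real j) < \<epsilon>"
    using LIMSEQ_D[OF S \<epsilon>(1)] by auto
  define M where "M = (\<Sum>j\<le>J. norm (S j))"
  have M: "norm (S j) \<le> \<epsilon> * real j + M" for j
  proof (cases "j \<le> J")
    case True
    then have "norm (S j) \<le> M" unfolding M_def by (intro member_le_sum) auto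
    moreover have "0 \<le> \<epsilon> * real j" using \<epsilon>(1) by simp
    ultimately show ?thesis by linarith
  next
    case False
    then have "norm (S j) \<le> \<epsilon> * real j" using J[of j] by (auto simp: field_simps)
    moreover have "0 \<le> M" unfolding M_def by (intro sum_nonneg) auto
    ultimately show ?thesis by linarith
  qed
  have "(\<lambda>n. h n * M) \<longlonglongrightarrow> 0" using tendsto_mult_left_zero[OF h(1)] .
  then have "\<forall>\<^sub>F n in sequentially. h n * M < \<sigma> / 2"
    using \<open>0 < \<sigma>\<close> by (intro order_tendstoD) auto
  then show ?thesis
  proof eventually_elim
    case (elim n)
    show ?case
    proof (intro allI impI)
      fix j assume "h n * real j \<le> T"
      then have "\<epsilon> * (h n * real j) \<le> \<sigma> / 2"
        using \<epsilon> by (meson less_imp_le mult_left_mono order_trans)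
      moreover have "h n * norm (S j) \<le> h n * (\<epsilon> * real j + M)"
        using M h(2)[of n] by (intro mult_left_mono) auto
      ultimately show "h n * norm (S j) \<le> \<sigma>" using elim by (simp add: algebra_simps)
    qed
  qed
qed

text \<open>The deterministic core, applied later to almost every realisation. Samples of
  \<open>V\<close> on the grid play the role of \<open>u\<close> in \<open>tracking\<close>, and the
  gap between \<open>R'\<close> and \<open>R\<close> is the room left for the error inside the
  ball.\<close>

theorem delayed_momentum_converges:
  fixes F :: "'b::real_normed_vector \<Rightarrow> 'a::real_normed_vector \<Rightarrow> 'a"
    and h :: "nat \<Rightarrow> real" and \<tau> :: "nat \<Rightarrow> nat \<Rightarrow> nat" and v :: "nat \<Rightarrow> int \<Rightarrow> 'a"
  assumes dm: "\<And>n. delayed_momentum F R B L a A Abar \<mu> (h n) (\<tau> n) v0 (v n)"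
    and h: "h \<longlonglongrightarrow> 0"
    and delay: "\<forall>\<^sub>F n in sequentially. \<forall>j\<ge>1. h n * real (\<tau> n j) \<le> \<theta> n" and \<theta>: "\<theta> \<longlonglongrightarrow> 0"
    and averages: "(\<lambda>k. (\<Sum>j=1..k. A j - Abar) /\<^sub>R real k) \<longlonglongrightarrow> 0"
    and V_0: "V 0 = v0" and V_bound: "\<And>t. 0 \<le> t \<Longrightarrow> norm (V t) \<le> R'" and R': "R' < R"
    and V_ode: "\<And>t. 0 \<le> t \<Longrightarrow>
          (V has_vector_derivative (1 / (1 - \<mu>)) *\<^sub>R F Abar (V t)) (at t within {0..})"
    and "0 < T" "0 < \<epsilon>"
  shows "\<forall>\<^sub>F n in sequentially. \<forall>t\<in>{0..T}. dist (v n \<lfloor>t / h n\<rfloor>) (V t) < \<epsilon>"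
proof -
  define c where "c = 1 / (1 - \<mu>)"
  define G where "G = c * B * a"
  define Q where "Q = c * L * a * G"
  interpret D0: delayed_momentum F R B L a A Abar \<mu> "h 0" "\<tau> 0" v0 "v 0" by (rule dm)
  have c: "1 \<le> c" using D0.c_ge_1 unfolding D0.c_def c_def .
  have G: "0 \<le> G" using D0.speed_nonneg unfolding D0.speed_def D0.c_def c_def G_def .
  have hpos: "0 < h n" for n using dm[of n] unfolding delayed_momentum_def by blast
  have T0: "0 \<le> T" using \<open>0 < T\<close> by simp
  have ode: "(V has_vector_derivative c *\<^sub>R F Abar (V t)) (at t within {0..})" if "0 \<le> t" for t
    using V_ode[OF that] unfolding c_def .
  have VR: "norm (V t) \<le> R" if "0 \<le> t" for t using V_bound[OF that] R' by linarith
  have speed: "norm (c *\<^sub>R F Abar (V t)) \<le> G" if "0 \<le> t" for t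
  proof -
    have "norm (F Abar (V t)) \<le> B * norm Abar" by (rule D0.F_bound[OF VR[OF that]])
    also have "\<dots> \<le> B * a" using D0.Abar_bound D0.B_nonneg by (simp add: mult_left_mono)
    finally show ?thesis using c by (simp add: G_def mult.assoc mult_left_mono)
  qed
  have lip: "norm (c *\<^sub>R F Abar (V s) - c *\<^sub>R F Abar (V t)) \<le> (c * L * a) * norm (V s - V t)"
    if "0 \<le> s" "0 \<le> t" for s t
  proof -
    have "norm (F Abar (V s) - F Abar (V t)) \<le> L * norm Abar * norm (V s - V t)"
      by (rule D0.F_lipschitz[OF VR[OF that(1)] VR[OF that(2)]])
    also have "\<dots> \<le> L * a * norm (V s - V t)"
      using D0.Abar_bound D0.L_nonneg by (intro mult_right_mono mult_left_mono) auto
    finally have "c * norm (F Abar (V s) - F Abar (V t)) \<le> c * (L * a * norm (V s - V t))"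
      using c by (intro mult_left_mono) auto
    then show ?thesis using c by (simp flip: scaleR_diff_right add: mult.assoc)
  qed
  have V_lip: "norm (V s - V t) \<le> G * \<bar>s - t\<bar>" if "0 \<le> s" "0 \<le> t" for s t
    by (rule vector_derivative_lipschitz[OF ode speed that])
  have V_step: "norm (V (t + \<eta>) - V t - \<eta> *\<^sub>R c *\<^sub>R F Abar (V t)) \<le> Q * \<eta>\<^sup>2" if "0 \<le> t" "0 \<le> \<eta>" for t \<eta>
    unfolding Q_def using that c D0.L_nonneg D0.a_nonneg
    by (intro euler_step_bound[OF ode speed lip]) auto
  \<comment> \<open>Half of \<open>\<epsilon>\<close> goes to the tracking error, half to the
    variation of \<open>V\<close> between grid points; the other bound keeps the iterates in the
    ball.\<close>
  define \<epsilon>' where "\<epsilon>' = min (\<epsilon> / 2) (R - R')"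
  have \<epsilon>': "0 < \<epsilon>'" "\<epsilon>' \<le> \<epsilon> / 2" "R' + \<epsilon>' \<le> R" using \<open>0 < \<epsilon>\<close> R' unfolding \<epsilon>'_def by linarith+
  define \<kappa> where "\<kappa> = c * (B + L * T * G) * exp (c * L * a * T)"
  have \<kappa>: "0 \<le> \<kappa>" using c D0.B_nonneg D0.L_nonneg T0 G by (simp add: \<kappa>_def)
  \<comment> \<open>The noise level is fixed before \<open>n\<close> grows. All other contributions
    to \<open>\<rho>\<close> vanish with \<open>h\<close> and \<open>\<theta>\<close>, leaving
    \<open>\<kappa> * \<sigma> < \<epsilon>'\<close>.\<close>
  define \<sigma> where "\<sigma> = \<epsilon>' / (2 * (\<kappa> + 1))"
  have \<sigma>: "0 < \<sigma>" "\<kappa> * \<sigma> < \<epsilon>'" using \<epsilon>'(1) \<kappa> by (auto simp: \<sigma>_def field_simps add_nonneg_pos)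
  define \<rho> where "\<rho> n = (Q * T * h n + c * T * L * a * G * \<theta> n + c * T * L * a * c * G * h n
      + c * (B + L * T * G) * \<sigma>) * exp (c * L * a * T) + c * G * h n" for n
  have "\<rho> \<longlonglongrightarrow> (Q * T * 0 + c * T * L * a * G * 0 + c * T * L * a * c * G * 0
      + c * (B + L * T * G) * \<sigma>) * exp (c * L * a * T) + c * G * 0"
    unfolding \<rho>_def by (intro tendsto_intros h \<theta>)
  then have "\<rho> \<longlonglongrightarrow> \<kappa> * \<sigma>" by (simp add: \<kappa>_def mult_ac)
  then have ev_\<rho>: "\<forall>\<^sub>F n in sequentially. \<rho> n < \<epsilon>'" using \<sigma>(2) by (rule order_tendstoD)
  \<comment> \<open>Rounding \<open>t\<close> down to the grid and the shift by one in
    \<open>u\<close> each cost at most one step, whence the factor 2.\<close>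
  have "(\<lambda>n. 2 * G * h n) \<longlonglongrightarrow> 2 * G * 0" by (intro tendsto_intros h)
  then have ev_h: "\<forall>\<^sub>F n in sequentially. 2 * G * h n < \<epsilon> / 2"
    using \<open>0 < \<epsilon>\<close> by (intro order_tendstoD) auto
  show ?thesis
    using scaled_partial_sums_small[OF averages h hpos T0 \<sigma>(1)] delay ev_\<rho> ev_h
  proof eventually_elim
    case (elim n)
    interpret D: delayed_momentum F R B L a A Abar \<mu> "h n" "\<tau> n" v0 "v n" by (rule dm)
    have Dc: "D.c = c" "D.speed = G" by (simp_all add: D.c_def D.speed_def c_def G_def)
    \<comment> \<open>The shift by one step is due to the initial condition \<open>v 1 = v0\<close>; it also gives \<open>u 0 = v0\<close>.\<close>
    define u where "u j = V (real (j - 1) * h n)" for j :: nat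
    define K where "K = nat \<lfloor>T / h n\<rfloor>"
    have K: "h n * real K \<le> T"
    proof -
      have "real K \<le> T / h n" unfolding K_def using T0 hpos[of n] by simp
      then show ?thesis using hpos[of n] by (simp add: field_simps)
    qed
    have track: "norm (v n (int k) - u k) \<le> \<epsilon>'" if "1 \<le> k" "k \<le> K" for k
    proof (rule D.tracking[OF K, where R' = R' and Q = Q and \<sigma> = \<sigma> and \<theta> = "\<theta> n"])
      show "h n * norm (D.noise j) \<le> \<sigma>" if "j \<le> K" for j
      proof -
        have "h n * real j \<le> h n * real K" using that hpos[of n] by simp
        then show ?thesis using elim(1) K unfolding D.noise_def by (meson order_trans)
      qed
      show "norm (u (Suc j) - u j - (h n * D.c) *\<^sub>R F Abar (u j)) \<le> Q * (h n)\<^sup>2" if "1 \<le> j" for j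
      proof -
        have "real j * h n = real (j - 1) * h n + h n"
          using that by (simp add: of_nat_diff algebra_simps)
        then show ?thesis
          using V_step[of "real (j - 1) * h n" "h n"] hpos[of n] by (simp add: u_def Dc)
      qed
      show "(Q * T * h n + D.c * T * L * a * D.speed * \<theta> n + D.c * T * L * a * D.c * D.speed * h n
          + D.c * (B + L * T * D.speed) * \<sigma>) * exp (D.c * L * a * T) + D.c * D.speed * h n \<le> \<epsilon>'"
        using elim(3) unfolding Dc \<rho>_def by simp
    qed (use elim(2) V_0 V_bound hpos[of n] R' \<epsilon>' that in \<open>auto simp: u_def\<close>)
    have "dist (v n \<lfloor>t / h n\<rfloor>) (V t) < \<epsilon>" if t: "t \<in> {0..T}" for t
    proof -
      define k where "k = nat \<lfloor>t / h n\<rfloor>"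
      have q0: "0 \<le> t / h n" using t hpos[of n] by simp
      then have k: "\<lfloor>t / h n\<rfloor> = int k" by (simp add: k_def)
      have "t / h n \<le> T / h n" using t hpos[of n] by (intro divide_right_mono) auto
      then have "k \<le> K" unfolding k_def K_def by (intro nat_mono floor_mono)
      have b: "norm (v n (int k) - u k) \<le> \<epsilon>'"
      proof (cases "k = 0")
        case True
        then show ?thesis using D.v_init[of 0] V_0 \<epsilon>' by (simp add: u_def)
      next
        case False
        then show ?thesis using track[of k] \<open>k \<le> K\<close> by simp
      qed
      have "real k \<le> t / h n" "t / h n < real k + 1"
        using k floor_correct[of "t / h n"] by auto
      then have kt: "real k * h n \<le> t" "t < (real k + 1) * h n"
        using hpos[of n] by (auto simp: field_simps)
      have "\<bar>real (k - 1) * h n - t\<bar> \<le> 2 * h n"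
        using kt hpos[of n] by (cases k) (auto simp: algebra_simps abs_if)
      then have "G * \<bar>real (k - 1) * h n - t\<bar> \<le> G * (2 * h n)"
        using G by (rule mult_left_mono)
      moreover have "norm (u k - V t) \<le> G * \<bar>real (k - 1) * h n - t\<bar>"
        unfolding u_def using t hpos[of n] by (intro V_lip) auto
      ultimately have "norm (u k - V t) < \<epsilon> / 2" using elim(4) by simp
      moreover have "dist (v n (int k)) (V t) \<le> norm (v n (int k) - u k) + norm (u k - V t)"
        unfolding dist_norm by (rule order_trans[OF _ norm_triangle_ineq]) simp
      ultimately show ?thesis using b \<epsilon>'(2) k by simp
    qed
    then show ?case by blast
  qed
qed


section \<open>A strong law of large numbers\<close>

text \<open>Hoeffding's inequality gives geometrically decaying tails for the deviation of the mean;
  they are summable, so the Borel-Cantelli lemma applies.\<close>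

lemma (in prob_space) bounded_strong_law:
  fixes X :: "nat \<Rightarrow> 'a \<Rightarrow> real"
  assumes indep: "indep_vars (\<lambda>_. borel) X {1..}"
    and distr: "\<And>k. 1 \<le> k \<Longrightarrow> distr M borel (X k) = distr M borel (X 1)"
    and bound: "AE \<omega> in M. \<bar>X 1 \<omega>\<bar> \<le> b"
  shows "AE \<omega> in M. (\<lambda>n. (\<Sum>k=1..n. X k \<omega>) / real n) \<longlonglongrightarrow> expectation (X 1)"
proof -
  \<comment> \<open>The \<open>+ 1\<close> makes the interval for Hoeffding's inequality
    nondegenerate, whatever \<open>b\<close> is.\<close>
  define b' where "b' = \<bar>b\<bar> + 1"
  have b': "AE \<omega> in M. X 1 \<omega> \<in> {-b'..b'}"
    using bound by eventually_elim (simp add: b'_def abs_le_iff)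
  have b'_pos: "0 < b'" by (simp add: b'_def)
  have meas [measurable]: "random_variable borel (X k)" if "1 \<le> k" for k
    using indep that unfolding indep_vars_def by blast
  define m where "m = expectation (X 1)"
  define dev where "dev n \<omega> = \<bar>(\<Sum>k=1..n. X k \<omega>) / real n - m\<bar>" for n \<omega>
  have dev_meas [measurable]: "random_variable borel (dev n)" for n
    unfolding dev_def by measurable
  have small: "AE \<omega> in M. \<forall>\<^sub>F n in sequentially. dev n \<omega> < \<epsilon>" if "0 < \<epsilon>" for \<epsilon>
  proof -
    define q where "q = exp (- 2 * \<epsilon>\<^sup>2 / (2 * b')\<^sup>2)"
    have tail: "prob {\<omega>\<in>space M. dev n \<omega> \<ge> \<epsilon>} \<le> 2 * q ^ n" if "1 \<le> n" for n
    proof -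
      interpret H: Hoeffding_ineq_iid M "{1..n}" X "X 1" "-b'" b' m
      proof unfold_locales
        show "indep_vars (\<lambda>_. borel) X {1..n}" by (rule indep_vars_subset[OF indep]) auto
        show "distr M borel (X i) = distr M borel (X 1)" if "i \<in> {1..n}" for i
          using that by (intro distr) simp
        show "random_variable borel (X 1)" by (rule meas) simp
        show "AE \<omega> in M. X 1 \<omega> \<in> {-b'..b'}" by (rule b')
      qed (simp_all add: m_def)
      have "prob {\<omega>\<in>space M. dev n \<omega> \<ge> \<epsilon>} \<le> 2 * exp (-2 * real n * \<epsilon>\<^sup>2 / (2 * b')\<^sup>2)"
        using H.Hoeffding_ineq_abs_ge'[of \<epsilon>] \<open>0 < \<epsilon>\<close> b'_pos that by (simp add: dev_def)
      also have "exp (-2 * real n * \<epsilon>\<^sup>2 / (2 * b')\<^sup>2) = q ^ n"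
        unfolding q_def exp_of_nat_mult[symmetric] by (simp add: field_simps)
      finally show ?thesis .
    qed
    have "0 \<le> q" "q < 1" using that b'_pos by (auto simp: q_def)
    then have "summable (\<lambda>n. 2 * q ^ n)" by (intro summable_mult summable_geometric) auto
    then have "summable (\<lambda>n. prob {\<omega>\<in>space M. dev n \<omega> \<ge> \<epsilon>})"
      by (rule summable_comparison_test'[where N = 1]) (use tail in auto)
    then have "AE \<omega> in M. \<forall>\<^sub>F n in sequentially. \<omega> \<in> space M - {\<omega>\<in>space M. dev n \<omega> \<ge> \<epsilon>}"
      by (intro borel_cantelli_AE1) (auto simp: emeasure_eq_measure)
    then show ?thesis
      by eventually_elim (auto simp: not_le elim: eventually_mono)
  qed
  \<comment> \<open>Restricting to countably many accuracies keeps the union of exceptional sets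
    null.\<close>
  have "AE \<omega> in M. \<forall>m. \<forall>\<^sub>F n in sequentially. dev n \<omega> < inverse (real (Suc m))"
    unfolding AE_all_countable by (intro allI small) simp
  then show ?thesis
  proof (rule AE_mp, intro AE_I2 impI)
    fix \<omega> assume dev: "\<forall>m. \<forall>\<^sub>F n in sequentially. dev n \<omega> < inverse (real (Suc m))"
    show "(\<lambda>n. (\<Sum>k=1..n. X k \<omega>) / real n) \<longlonglongrightarrow> expectation (X 1)"
    proof (rule tendstoI)
      fix e :: real assume "0 < e"
      then obtain m where "inverse (real (Suc m)) < e" using reals_Archimedean by blast
      then show "\<forall>\<^sub>F n in sequentially.
          dist ((\<Sum>k=1..n. X k \<omega>) / real n) (expectation (X 1)) < e"
        using dev[rule_format, of m] by (auto simp: dist_real_def dev_def m_def elim!: eventually_mono)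
    qed
  qed
qed


section \<open>Oja's flow\<close>

text \<open>The matrix exponential applied to \<open>x0\<close>, written coordinatewise as real
  power series: \<open>x k\<close> is the \<open>k\<close>-th power of \<open>A\<close> applied to
  \<open>x0\<close>. The exponential series of \<open>onorm\<close> times
  \<open>\<bar>t\<bar>\<close> dominates each coordinate.\<close>

lemma linear_ode_solution:
  fixes A :: "real^'n^'n" and x0 :: "real^'n"
  obtains u where "u 0 = x0" "\<And>t. (u has_vector_derivative A *v u t) (at t)"
proof
  define x where "x k = ((*v) A ^^ k) x0" for k
  define p where "p i k = x k $ i / fact k" for i k
  define u where "u t = (\<chi> i. \<Sum>k. p i k * t ^ k)" for t :: real
  have x_Suc: "x (Suc k) = A *v x k" for k by (simp add: x_def)
  have x_bound: "norm (x k) \<le> onorm ((*v) A) ^ k * norm x0" for k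
  proof (induction k)
    case (Suc k)
    have "norm (x (Suc k)) \<le> onorm ((*v) A) * norm (x k)"
      unfolding x_Suc by (rule onorm) simp
    also have "\<dots> \<le> onorm ((*v) A) * (onorm ((*v) A) ^ k * norm x0)"
      using Suc by (intro mult_left_mono onorm_pos_le) auto
    finally show ?case by simp
  qed (simp add: x_def)
  have summable: "summable (\<lambda>k. p i k * t ^ k)" for i t
  proof (rule summable_comparison_test')
    show "summable (\<lambda>k. norm x0 * (inverse (fact k) * (onorm ((*v) A) * \<bar>t\<bar>) ^ k))"
      by (intro summable_mult summable_exp)
    show "norm (p i k * t ^ k) \<le> norm x0 * (inverse (fact k) * (onorm ((*v) A) * \<bar>t\<bar>) ^ k)" for k
    proof -
      have "\<bar>x k $ i\<bar> \<le> onorm ((*v) A) ^ k * norm x0"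
        using component_le_norm_cart[of "x k" i] x_bound[of k] by linarith
      then have "\<bar>x k $ i\<bar> * (\<bar>t\<bar> ^ k / fact k) \<le> (onorm ((*v) A) ^ k * norm x0) * (\<bar>t\<bar> ^ k / fact k)"
        by (intro mult_right_mono) auto
      then show ?thesis
        by (simp add: p_def abs_mult power_abs power_mult_distrib field_simps)
    qed
  qed
  \<comment> \<open>Termwise differentiation shifts the series by one index, and
    \<open>x (Suc k) = A *v x k\<close> turns the shift into an application of
    \<open>A\<close>.\<close>
  have diffs: "diffs (p i) k * t ^ k = (\<Sum>j\<in>UNIV. A $ i $ j * (p j k * t ^ k))" for i k t
    unfolding diffs_def p_def x_Suc matrix_vector_mult_def
    by (simp add: sum_divide_distrib sum_distrib_left sum_distrib_right field_simps del: of_nat_Suc)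
  have comp: "((\<lambda>t. u t $ i) has_real_derivative (A *v u t) $ i) (at t)" for i t
  proof -
    have "((\<lambda>t. \<Sum>k. p i k * t ^ k) has_real_derivative (\<Sum>k. diffs (p i) k * t ^ k)) (at t)"
      by (rule termdiffs_strong_converges_everywhere[OF summable])
    also have "(\<Sum>k. diffs (p i) k * t ^ k) = (\<Sum>j\<in>UNIV. A $ i $ j * (\<Sum>k. p j k * t ^ k))"
      unfolding diffs using summable by (subst suminf_sum) (auto simp: suminf_mult intro: summable_mult)
    finally show ?thesis by (simp add: u_def matrix_vector_mult_def)
  qed
  show "u 0 = x0" by (simp add: u_def vec_eq_iff) (simp add: p_def x_def)
  show "(u has_vector_derivative A *v u t) (at t)" for t
    unfolding has_vector_derivative_def
    using comp[of _ t]
    by (subst has_derivative_componentwise_within)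
      (auto simp: Basis_vec_def inner_axis has_field_derivative_def mult_commute_abs)
qed

text \<open>Oja's flow is the radial projection of the linear flow.  Positivity of \<open>A\<close> makes the norm of the
  linear flow nondecreasing, so that the projection is defined for all times.\<close>

lemma oja_flow_exists:
  fixes A :: "real^'n^'n" and x0 :: "real^'n"
  assumes A: "\<And>x. 0 \<le> x \<bullet> (A *v x)" and x0: "norm x0 = 1"
  obtains V where "V 0 = x0" "\<And>t. 0 \<le> t \<Longrightarrow> norm (V t) = 1"
    "\<And>t. 0 \<le> t \<Longrightarrow> (V has_vector_derivative A *v V t - (V t \<bullet> (A *v V t)) *\<^sub>R V t) (at t within {0..})"
proof -
  obtain u where u: "u 0 = x0" "\<And>t. (u has_vector_derivative A *v u t) (at t)"
    using linear_ode_solution by blast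
  have sq: "((\<lambda>t. u t \<bullet> u t) has_real_derivative 2 * (u t \<bullet> (A *v u t))) (at t)" for t
    using u(2)[of t] unfolding has_vector_derivative_def has_field_derivative_def
    by (auto intro!: derivative_eq_intros simp: inner_commute algebra_simps)
  have pos: "0 < u t \<bullet> u t" if "0 \<le> t" for t
  proof -
    have "u 0 \<bullet> u 0 \<le> u t \<bullet> u t"
      using that
    proof (rule DERIV_nonneg_imp_nondecreasing)
      show "\<exists>y. ((\<lambda>t. u t \<bullet> u t) has_real_derivative y) (at s) \<and> 0 \<le> y" for s
        using sq[of s] A[of "u s"] by (intro exI[of _ "2 * (u s \<bullet> (A *v u s))"]) simp
    qed
    moreover have "u 0 \<bullet> u 0 = 1" using u(1) x0 by (simp add: norm_eq_1)
    ultimately show ?thesis by linarith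
  qed
  define V where "V t = (1 / sqrt (u t \<bullet> u t)) *\<^sub>R u t" for t
  show thesis
  proof
    show "V 0 = x0" using u(1) x0 by (simp add: V_def norm_eq_1)
    show "norm (V t) = 1" if "0 \<le> t" for t
      using pos[OF that] by (simp add: V_def norm_eq_sqrt_inner)
    fix t :: real assume "0 \<le> t"
    define s where "s = sqrt (u t \<bullet> u t)"
    have s: "0 < s" using pos[OF \<open>0 \<le> t\<close>] by (simp add: s_def)
    have d: "((\<lambda>t. 1 / sqrt (u t \<bullet> u t)) has_real_derivative - (u t \<bullet> (A *v u t)) / s ^ 3) (at t)"
      using pos[OF \<open>0 \<le> t\<close>] s inner_ge_zero[of "u t"]
      by (auto intro!: derivative_eq_intros sq simp: s_def[symmetric] power3_eq_cube field_simps
          simp del: inner_ge_zero)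
    have "(V has_vector_derivative (1 / s) *\<^sub>R (A *v u t) + (- (u t \<bullet> (A *v u t)) / s ^ 3) *\<^sub>R u t) (at t)"
      unfolding V_def[abs_def] s_def
      by (rule has_vector_derivative_scaleR[OF d[unfolded s_def] u(2)])
    \<comment> \<open>With \<open>V = u / s\<close>, the quadratic form contributes
      \<open>1 / s ^ 2\<close> and the vector \<open>1 / s\<close>, which accounts for the
      cube.\<close>
    also have "(1 / s) *\<^sub>R (A *v u t) + (- (u t \<bullet> (A *v u t)) / s ^ 3) *\<^sub>R u t
        = A *v V t - (V t \<bullet> (A *v V t)) *\<^sub>R V t"
      using s unfolding V_def s_def[symmetric]
      by (simp add: matrix_vector_mult_scaleR power3_eq_cube)
    finally show "(V has_vector_derivative A *v V t - (V t \<bullet> (A *v V t)) *\<^sub>R V t) (at t within {0..})"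
      by (rule has_vector_derivative_at_within)
  qed
qed


section \<open>Convergence in the Skorokhod topology\<close>

lemma interpolation_cadlag:
  assumes "0 < \<eta>"
  shows "interpolation \<eta> v \<in> cadlag_paths"
  unfolding cadlag_paths_def
proof (intro CollectI conjI allI impI)
  show "interpolation \<eta> v \<in> extensional {0..}"
    by (simp add: interpolation_def)
  fix t :: real
  assume t: "0 \<le> t"
  define k where "k = \<lfloor>t / \<eta>\<rfloor>"
  have k: "of_int k \<le> t / \<eta>" "t / \<eta> < of_int k + 1"
    unfolding k_def by (simp_all add: floor_less_cancel)
  have "\<forall>\<^sub>F s in at_right t. interpolation \<eta> v s = interpolation \<eta> v t"
    unfolding eventually_at_right_field
  proof (intro exI[of _ "(of_int k + 1) * \<eta>"] conjI allI impI)
    show "t < (of_int k + 1) * \<eta>" using k(2) assms by (simp add: field_simps)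
    fix s assume s: "t < s" "s < (of_int k + 1) * \<eta>"
    have "\<lfloor>s / \<eta>\<rfloor> = k"
    proof (rule floor_unique)
      show "of_int k \<le> s / \<eta>" using k(1) s(1) assms by (simp add: field_simps)
      show "s / \<eta> < of_int k + 1" using s(2) assms by (simp add: field_simps)
    qed
    then show "interpolation \<eta> v s = interpolation \<eta> v t"
      using s(1) t by (simp add: interpolation_def k_def)
  qed
  then show "(interpolation \<eta> v \<longlongrightarrow> interpolation \<eta> v t) (at_right t)"
    by (rule tendsto_eventually)
next
  fix t :: real
  assume t: "0 < t"
  \<comment> \<open>At a grid point the left limit is the value at the preceding index; hence the
    ceiling minus 1 and not the floor.\<close>
  define k where "k = \<lceil>t / \<eta>\<rceil> - 1"
  have k: "of_int k < t / \<eta>" "t / \<eta> \<le> of_int k + 1"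
    using ceiling_correct[of "t / \<eta>"] by (auto simp: k_def)
  have "0 < t / \<eta>" using t assms by simp
  \<comment> \<open>This keeps the points between \<open>k * \<eta>\<close> and \<open>t\<close>
    nonnegative, where the restricted path takes the values of \<open>v\<close>.\<close>
  then have k0: "0 \<le> k" using k(2) by linarith
  have "\<forall>\<^sub>F s in at_left t. interpolation \<eta> v s = v k"
    unfolding eventually_at_left_field
  proof (intro exI[of _ "of_int k * \<eta>"] conjI allI impI)
    show "of_int k * \<eta> < t" using k(1) assms by (simp add: field_simps)
    fix s assume s: "of_int k * \<eta> < s" "s < t"
    have "\<lfloor>s / \<eta>\<rfloor> = k"
    proof (rule floor_unique)
      show "of_int k \<le> s / \<eta>" using s(1) assms by (simp add: field_simps)
      have "s / \<eta> < t / \<eta>" using s(2) assms by (simp add: divide_strict_right_mono)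
      then show "s / \<eta> < of_int k + 1" using k(2) by linarith
    qed
    moreover have "0 \<le> of_int k * \<eta>" using k0 assms by simp
    ultimately show "interpolation \<eta> v s = v k"
      using s(1) by (simp add: interpolation_def)
  qed
  then show "\<exists>l. (interpolation \<eta> v \<longlongrightarrow> l) (at_left t)"
    using tendsto_eventually by blast
qed

lemma continuous_cadlag:
  fixes V :: "real \<Rightarrow> 'a::metric_space"
  assumes "continuous_on {0..} V"
  shows "restrict V {0..} \<in> cadlag_paths"
  unfolding cadlag_paths_def
proof (intro CollectI conjI allI impI)
  have cont: "(V \<longlongrightarrow> V t) (at t within {0..})" if "0 \<le> t" for t
    using assms that by (auto simp: continuous_on_def)
  fix t :: real
  assume "0 \<le> t"
  have "(V \<longlongrightarrow> V t) (at_right t)"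
    by (rule tendsto_within_subset[OF cont]) (use \<open>0 \<le> t\<close> in auto)
  moreover have "\<forall>\<^sub>F s in at_right t. V s = restrict V {0..} s"
    unfolding eventually_at_right_field using \<open>0 \<le> t\<close> by (intro exI[of _ "t + 1"]) auto
  ultimately show "(restrict V {0..} \<longlongrightarrow> restrict V {0..} t) (at_right t)"
    using \<open>0 \<le> t\<close> by (auto intro: Lim_transform_eventually)
next
  fix t :: real
  assume "0 < t"
  then have "(V \<longlongrightarrow> V t) (at t within {0..})"
    using assms by (auto simp: continuous_on_def)
  then have "(V \<longlongrightarrow> V t) (at t)"
    using \<open>0 < t\<close> at_within_interior[of t "{0..}"] by simp
  then have "(V \<longlongrightarrow> V t) (at_left t)"
    by (rule tendsto_within_subset) auto
  moreover have "\<forall>\<^sub>F s in at_left t. V s = restrict V {0..} s"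
    unfolding eventually_at_left_field using \<open>0 < t\<close> by (intro exI[of _ 0]) auto
  ultimately show "\<exists>l. (restrict V {0..} \<longlongrightarrow> l) (at_left t)"
    using Lim_transform_eventually by blast
qed simp

text \<open>The identity serves as the time change.\<close>

lemma uniform_ball_subset_skorokhod_nbhd:
  assumes "y \<in> cadlag_paths" "\<And>t. t \<in> {0..T} \<Longrightarrow> dist (y t) (x t) < \<epsilon>" "0 < \<epsilon>"
  shows "y \<in> skorokhod_nbhd x T \<epsilon>"
proof -
  have "(\<lambda>t. t) \<in> time_changes"
    by (auto simp: time_changes_def strict_mono_on_def)
  then show ?thesis
    unfolding skorokhod_nbhd_def using assms by (auto intro!: bexI[of _ "\<lambda>t. t"])
qed

section \<open>Borel sets of the path space and weak convergence\<close>

lemma space_borel_of: "space (borel_of T) = topspace T"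
  unfolding borel_of_def by (rule space_measure_of) (auto dest: openin_subset)

lemma sets_borel_of: "sets (borel_of T) = sigma_sets (topspace T) {U. openin T U}"
  unfolding borel_of_def by (rule sets_measure_of) (auto dest: openin_subset)

lemma continuous_map_borel_of:
  assumes "continuous_map T euclideanreal f"
  shows "f \<in> borel_measurable (borel_of T)"
proof (rule borel_measurableI)
  fix S :: "real set" assume "open S"
  then have "openin T {x \<in> topspace T. f x \<in> S}"
    using assms by (intro openin_continuous_map_preimage) auto
  moreover have "f -` S \<inter> space (borel_of T) = {x \<in> topspace T. f x \<in> S}"
    by (auto simp: space_borel_of)
  ultimately show "f -` S \<inter> space (borel_of T) \<in> sets (borel_of T)"
    by (auto simp: sets_borel_of)
qed

text \<open>On \<open>[0,T]\<close> the interpolation reads only the coordinates up to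
  \<open>K\<close>, so a finite intersection of coordinate balls maps into the neighbourhood.
  Indexing by naturals suffices for nonnegative times and gives a countable product.\<close>

lemma open_interpolation_preimage:
  fixes U :: "(real \<Rightarrow> real^'n) set"
  assumes "openin skorokhod_topology U" "0 < \<eta>"
  shows "open {w :: nat \<Rightarrow> real^'n. interpolation \<eta> (\<lambda>i. w (nat i)) \<in> U}"
proof (subst open_subopen, intro ballI)
  fix w :: "nat \<Rightarrow> real^'n"
  assume "w \<in> {w. interpolation \<eta> (\<lambda>i. w (nat i)) \<in> U}"
  then obtain T \<epsilon> where T: "0 < T" "0 < \<epsilon>"
    "skorokhod_nbhd (interpolation \<eta> (\<lambda>i. w (nat i))) T \<epsilon> \<subseteq> U"
    using assms(1) unfolding openin_skorokhod by blast
  define K where "K = nat \<lfloor>T / \<eta>\<rfloor>"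
  define W where "W = (\<Inter>k\<le>K. (\<lambda>w'. w' k) -` ball (w k) \<epsilon>)"
  have "open W"
    unfolding W_def
    by (intro open_INT ballI open_vimage) (auto intro: continuous_on_product_coordinates)
  moreover have "w \<in> W" using T(2) by (simp add: W_def)
  moreover have "W \<subseteq> {w. interpolation \<eta> (\<lambda>i. w (nat i)) \<in> U}"
  proof
    fix w' assume w': "w' \<in> W"
    have "interpolation \<eta> (\<lambda>i. w' (nat i)) \<in> skorokhod_nbhd (interpolation \<eta> (\<lambda>i. w (nat i))) T \<epsilon>"
    proof (rule uniform_ball_subset_skorokhod_nbhd[OF interpolation_cadlag[OF assms(2)] _ T(2)])
      fix t assume t: "t \<in> {0..T}"
      then have "t / \<eta> \<le> T / \<eta>" using assms(2) by (intro divide_right_mono) auto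
      then have "nat \<lfloor>t / \<eta>\<rfloor> \<le> K" unfolding K_def by (intro nat_mono floor_mono)
      then show "dist (interpolation \<eta> (\<lambda>i. w' (nat i)) t) (interpolation \<eta> (\<lambda>i. w (nat i)) t) < \<epsilon>"
        using w' t by (auto simp: W_def interpolation_def dist_commute)
    qed
    then show "w' \<in> {w. interpolation \<eta> (\<lambda>i. w (nat i)) \<in> U}" using T(3) by blast
  qed
  ultimately show "\<exists>S. open S \<and> w \<in> S \<and> S \<subseteq> {w. interpolation \<eta> (\<lambda>i. w (nat i)) \<in> U}"
    by blast
qed

text \<open>The path factors through the sequence space, where measurability can be checked
  coordinatewise and preimages of Skorokhod-open sets are open.\<close>

lemma interpolation_measurable:
  fixes v :: "int \<Rightarrow> 'w \<Rightarrow> real^'n"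
  assumes v: "\<And>k. v k \<in> borel_measurable M" and "0 < \<eta>"
  shows "(\<lambda>\<omega>. interpolation \<eta> (\<lambda>k. v k \<omega>)) \<in> M \<rightarrow>\<^sub>M borel_of skorokhod_topology"
  unfolding borel_of_def
proof (rule measurable_measure_of)
  define w where "w \<omega> k = v (int k) \<omega>" for \<omega> k
  have "w \<in> M \<rightarrow>\<^sub>M borel"
    unfolding w_def by (rule measurable_coordinatewise_then_product) (rule v)
  moreover have eq: "interpolation \<eta> (\<lambda>k. v k \<omega>) = interpolation \<eta> (\<lambda>i. w \<omega> (nat i))" for \<omega>
    using assms(2) by (auto simp: interpolation_def w_def)
  moreover fix U :: "(real \<Rightarrow> real^'n) set"
  assume "U \<in> {U. openin skorokhod_topology U}"
  then have "open {w :: nat \<Rightarrow> real^'n. interpolation \<eta> (\<lambda>i. w (nat i)) \<in> U}"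
    using open_interpolation_preimage assms(2) by blast
  ultimately have "w -` {w. interpolation \<eta> (\<lambda>i. w (nat i)) \<in> U} \<inter> space M \<in> sets M"
    by (intro measurable_sets[of w M borel]) auto
  then show "(\<lambda>\<omega>. interpolation \<eta> (\<lambda>k. v k \<omega>)) -` U \<inter> space M \<in> sets M"
    by (simp add: eq vimage_def)
qed (use assms(2) in \<open>auto simp: topspace_skorokhod interpolation_cadlag openin_skorokhod\<close>)

text \<open>The natural numbers \<open>m\<close> and \<open>i\<close> exhaust all horizons and
  accuracies. On the good event every neighbourhood of \<open>V\<close> is eventually entered, so
  \<open>f (Y n \<omega>)\<close> tends to \<open>f V\<close>. As the limit is constant, its
  integral is \<open>f V\<close> under both \<open>M\<close> and \<open>N\<close>.\<close>

lemma converges_weakly_to_point: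
  fixes Y :: "nat \<Rightarrow> 'w \<Rightarrow> real \<Rightarrow> 'a::metric_space"
  assumes "prob_space M" "prob_space N"
    and Y: "\<And>n. Y n \<in> M \<rightarrow>\<^sub>M borel_of skorokhod_topology" and V: "V \<in> cadlag_paths"
    and unif: "AE \<omega> in M. \<forall>m::nat. \<forall>i::nat. \<forall>\<^sub>F n in sequentially.
      \<forall>t\<in>{0..real m}. dist (Y n \<omega> t) (V t) < inverse (real (Suc i))"
  shows "converges_weakly skorokhod_topology M Y N (\<lambda>_. V)"
  unfolding converges_weakly_def
proof (intro conjI allI impI)
  interpret M: prob_space M by fact
  interpret N: prob_space N by fact
  show "Y n \<in> M \<rightarrow>\<^sub>M borel_of skorokhod_topology" for n by (rule Y)
  show "(\<lambda>_. V) \<in> N \<rightarrow>\<^sub>M borel_of skorokhod_topology"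
    using V by (simp add: space_borel_of topspace_skorokhod)
  fix f :: "(real \<Rightarrow> 'a) \<Rightarrow> real"
  assume f: "continuous_map skorokhod_topology euclideanreal f
      \<and> bounded (f ` topspace skorokhod_topology)"
  have Y_path: "Y n \<omega> \<in> cadlag_paths" if "\<omega> \<in> space M" for n \<omega>
    using measurable_space[OF Y that] by (simp add: space_borel_of topspace_skorokhod)
  obtain b where b: "\<And>x. x \<in> cadlag_paths \<Longrightarrow> \<bar>f x\<bar> \<le> b"
    using f by (auto simp: bounded_iff topspace_skorokhod)
  have "(\<lambda>n. \<integral>\<omega>. f (Y n \<omega>) \<partial>M) \<longlonglongrightarrow> (\<integral>\<omega>. f V \<partial>M)"
  proof (rule integral_dominated_convergence[where w = "\<lambda>_. b"])
    show "(\<lambda>\<omega>. f (Y n \<omega>)) \<in> borel_measurable M" for n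
      by (rule measurable_compose[OF Y continuous_map_borel_of]) (use f in blast)
    show "AE \<omega> in M. norm (f (Y n \<omega>)) \<le> b" for n
      using b Y_path by (intro AE_I2) auto
    show "AE \<omega> in M. (\<lambda>n. f (Y n \<omega>)) \<longlonglongrightarrow> f V"
      using unif
    proof (rule AE_mp, intro AE_I2 impI tendstoI)
      fix \<omega> and e :: real
      assume \<omega>: "\<omega> \<in> space M" and "0 < e"
        and unif: "\<forall>m::nat. \<forall>i::nat. \<forall>\<^sub>F n in sequentially.
          \<forall>t\<in>{0..real m}. dist (Y n \<omega> t) (V t) < inverse (real (Suc i))"
      have "openin skorokhod_topology {x \<in> topspace skorokhod_topology. f x \<in> ball (f V) e}"
        using f by (intro openin_continuous_map_preimage) auto
      then obtain T \<epsilon> where T: "0 < T" "0 < \<epsilon>" "skorokhod_nbhd V T \<epsilon> \<subseteq> {x. f x \<in> ball (f V) e}"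
        unfolding openin_skorokhod using V \<open>0 < e\<close> by (fastforce simp: topspace_skorokhod)
      obtain m :: nat where m: "T \<le> real m" using real_arch_simple by blast
      obtain i where i: "inverse (real (Suc i)) < \<epsilon>" using T(2) reals_Archimedean by blast
      show "\<forall>\<^sub>F n in sequentially. dist (f (Y n \<omega>)) (f V) < e"
        using unif[rule_format, of m i]
      proof eventually_elim
        case (elim n)
        have "Y n \<omega> \<in> skorokhod_nbhd V T \<epsilon>"
          using elim m i by (intro uniform_ball_subset_skorokhod_nbhd Y_path \<omega> T(2)) force+
        then show ?case using T(3) by (auto simp: dist_commute)
      qed
    qed
  qed auto
  then show "(\<lambda>n. \<integral>\<omega>. f (Y n \<omega>) \<partial>M) \<longlonglongrightarrow> (\<integral>\<omega>. f V \<partial>N)"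
    by (simp add: M.prob_space N.prob_space)
qed


section \<open>Streaming PCA\<close>

text \<open>Serves both as the stochastic gradient, with \<open>M = outer x x\<close>, and as the
  mean drift, with \<open>M = \<Sigma>\<close>; linearity in \<open>M\<close> separates the
  noise.\<close>

definition oja_field :: "real^'n^'n \<Rightarrow> real^'n \<Rightarrow> real^'n" where
  "oja_field M x = M *v x - (x \<bullet> (M *v x)) *\<^sub>R x"

text \<open>The norm on matrices is the Frobenius norm, so Cauchy-Schwarz on each row
  suffices.\<close>

lemma norm_matrix_vector_mult_le:
  fixes M :: "real^'n^'m" and x :: "real^'n"
  shows "norm (M *v x) \<le> norm M * norm x"
proof -
  have "norm (M *v x) \<le> L2_set (\<lambda>i. norm (M $ i) * norm x) UNIV"
    unfolding norm_vec_def[of "M *v x"]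
    by (intro L2_set_mono) (auto simp: matrix_vector_mul_component Cauchy_Schwarz_ineq2)
  also have "\<dots> = norm M * norm x"
    by (simp add: norm_vec_def[of M] L2_set_left_distrib)
  finally show ?thesis .
qed

lemma linear_oja_field: "linear (\<lambda>M. oja_field M x)"
  by (intro linearI) (simp_all add: oja_field_def matrix_vector_mult_add_rdistrib inner_add_right
      scaleR_matrix_vector_assoc[symmetric] algebra_simps)

text \<open>The constant is 2 from the linear term plus 8 from the cubic term on the ball of radius
  2.\<close>

lemma oja_field_bound:
  assumes "norm x \<le> 2"
  shows "norm (oja_field M x) \<le> 10 * norm M"
proof -
  have 1: "norm (M *v x) \<le> norm M * 2"
    using assms by (intro order_trans[OF norm_matrix_vector_mult_le] mult_left_mono) auto
  have "norm ((x \<bullet> (M *v x)) *\<^sub>R x) \<le> (norm x * norm (M *v x)) * norm x"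
    using Cauchy_Schwarz_ineq2[of x "M *v x"] by (simp add: mult_right_mono)
  also have "\<dots> \<le> (2 * (norm M * 2)) * 2"
    using 1 assms by (intro mult_mono) auto
  finally show ?thesis
    using 1 norm_triangle_ineq4[of "M *v x" "(x \<bullet> (M *v x)) *\<^sub>R x"]
    unfolding oja_field_def by simp
qed

text \<open>The constant is 1 from the linear term plus 4 for each of the three factors of the cubic
  term.\<close>

lemma oja_field_lipschitz:
  assumes x: "norm x \<le> 2" and y: "norm y \<le> 2"
  shows "norm (oja_field M x - oja_field M y) \<le> 13 * norm M * norm (x - y)"
proof -
  define m where "m = norm M"
  define d where "d = norm (x - y)"
  have m: "0 \<le> m" "0 \<le> d" by (auto simp: m_def d_def)
  have Mx: "norm (M *v x) \<le> m * 2"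
    unfolding m_def using x by (intro order_trans[OF norm_matrix_vector_mult_le] mult_left_mono) auto
  have Md: "norm (M *v (x - y)) \<le> m * d"
    unfolding m_def d_def by (rule norm_matrix_vector_mult_le)
  \<comment> \<open>The occurrences of \<open>x\<close> in the cubic term are exchanged for
    \<open>y\<close> one at a time.\<close>
  have eq: "oja_field M x - oja_field M y = M *v (x - y) - (x \<bullet> (M *v x)) *\<^sub>R (x - y)
      - ((x - y) \<bullet> (M *v x)) *\<^sub>R y - (y \<bullet> (M *v (x - y))) *\<^sub>R y"
    unfolding oja_field_def by (simp add: matrix_vector_mult_diff_distrib algebra_simps inner_diff)
  have 1: "norm ((x \<bullet> (M *v x)) *\<^sub>R (x - y)) \<le> (2 * (m * 2)) * d"
  proof -
    have "\<bar>x \<bullet> (M *v x)\<bar> \<le> 2 * (m * 2)"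
      using x Mx by (intro order_trans[OF Cauchy_Schwarz_ineq2] mult_mono) auto
    then show ?thesis unfolding d_def by (simp add: mult_right_mono)
  qed
  have 2: "norm (((x - y) \<bullet> (M *v x)) *\<^sub>R y) \<le> (d * (m * 2)) * 2"
  proof -
    have "\<bar>(x - y) \<bullet> (M *v x)\<bar> \<le> d * (m * 2)"
      unfolding d_def using Mx by (intro order_trans[OF Cauchy_Schwarz_ineq2] mult_mono) auto
    then have "\<bar>(x - y) \<bullet> (M *v x)\<bar> * norm y \<le> (d * (m * 2)) * 2"
      using y m by (intro mult_mono) auto
    then show ?thesis by simp
  qed
  have 3: "norm ((y \<bullet> (M *v (x - y))) *\<^sub>R y) \<le> (2 * (m * d)) * 2"
  proof -
    have "\<bar>y \<bullet> (M *v (x - y))\<bar> \<le> 2 * (m * d)"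
      using y Md by (intro order_trans[OF Cauchy_Schwarz_ineq2] mult_mono) auto
    then have "\<bar>y \<bullet> (M *v (x - y))\<bar> * norm y \<le> (2 * (m * d)) * 2"
      using y m by (intro mult_mono) auto
    then show ?thesis by simp
  qed
  have "norm (oja_field M x - oja_field M y) \<le> norm (M *v (x - y)) + norm ((x \<bullet> (M *v x)) *\<^sub>R (x - y))
      + norm (((x - y) \<bullet> (M *v x)) *\<^sub>R y) + norm ((y \<bullet> (M *v (x - y))) *\<^sub>R y)"
    unfolding eq by (intro order_trans[OF norm_triangle_ineq4] add_mono order_refl)
  also have "\<dots> \<le> m * d + (2 * (m * 2)) * d + (d * (m * 2)) * 2 + (2 * (m * d)) * 2"
    using Md 1 2 3 by linarith
  finally show ?thesis by (simp add: m_def d_def mult_ac)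
qed

section \<open>Rank-one matrices and the stochastic gradient\<close>

lemma outer_mult: "outer x y *v z = (y \<bullet> z) *\<^sub>R x"
  by (simp add: vec_eq_iff outer_def matrix_vector_mult_def inner_vec_def sum_distrib_left mult_ac)

lemma norm_outer: "norm (outer x y) = norm x * norm y"
proof -
  have row: "outer x y $ i = x $ i *\<^sub>R y" for i
    by (simp add: outer_def vec_eq_iff)
  show ?thesis
    unfolding norm_vec_def[of "outer x y"] norm_vec_def[of x] row
    by (simp add: L2_set_left_distrib)
qed

lemma async_msgd_gradient:
  "((mat 1 - outer w w) ** outer x x) *v w = oja_field (outer x x) w"
proof -
  have "((mat 1 - outer w w) ** outer x x) *v w = (mat 1 - outer w w) *v (outer x x *v w)"
    by (simp add: matrix_vector_mul_assoc)
  also have "\<dots> = outer x x *v w - outer w w *v (outer x x *v w)"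
    by (simp add: matrix_vector_mult_diff_rdistrib)
  \<comment> \<open>The instance \<open>[of w w]\<close> leaves \<open>outer x x *v w\<close>
    intact, as the field is stated in terms of it.\<close>
  finally show ?thesis unfolding oja_field_def by (simp only: outer_mult[of w w])
qed

text \<open>Each iterate is an explicit measurable expression in earlier ones. The induction covers
  all indices up to \<open>k\<close> at once, since a delay may point to any of them.\<close>

lemma async_msgd_measurable:
  fixes v :: "int \<Rightarrow> 'w \<Rightarrow> real^'n"
  assumes X: "\<And>k. 1 \<le> k \<Longrightarrow> X k \<in> borel_measurable M"
    and v: "\<And>\<omega>. \<omega> \<in> space M \<Longrightarrow> async_msgd \<mu> \<eta> \<tau> (\<lambda>k. X k \<omega>) v0 (\<lambda>k. v k \<omega>)"
  shows "v i \<in> borel_measurable M"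
proof -
  have init: "v i \<in> borel_measurable M" if "i \<le> 1" for i
  proof -
    have "v i \<in> borel_measurable M \<longleftrightarrow> (\<lambda>_. v0) \<in> borel_measurable M"
      using v that by (intro measurable_cong) (auto simp: async_msgd_def)
    then show ?thesis by simp
  qed
  have "\<forall>i\<le>int k. v i \<in> borel_measurable M" for k
  proof (induction k)
    case 0
    then show ?case using init by simp
  next
    case (Suc k)
    have "v (int (Suc k)) \<in> borel_measurable M"
    proof (cases "k = 0")
      case True
      then show ?thesis using init by simp
    next
      case False
      let ?w = "v (int k - int (\<tau> k))"
      have [measurable]: "v (int k) \<in> borel_measurable M" "v (int k - 1) \<in> borel_measurable M"
        "?w \<in> borel_measurable M" "X k \<in> borel_measurable M"
        using Suc X False by auto
      have "v (int (Suc k)) \<in> borel_measurable M \<longleftrightarrow>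
        (\<lambda>\<omega>. v (int k) \<omega> + \<mu> *\<^sub>R (v (int k) \<omega> - v (int k - 1) \<omega>)
          + \<eta> *\<^sub>R ((X k \<omega> \<bullet> ?w \<omega>) *\<^sub>R X k \<omega>
            - (?w \<omega> \<bullet> ((X k \<omega> \<bullet> ?w \<omega>) *\<^sub>R X k \<omega>)) *\<^sub>R ?w \<omega>)) \<in> borel_measurable M"
        using v False by (intro measurable_cong)
          (auto simp: async_msgd_def async_msgd_gradient oja_field_def outer_mult add.commute[of 1])
      then show ?thesis by simp
    qed
    moreover have "i \<le> int k \<or> i = int (Suc k)" if "i \<le> int (Suc k)" for i
      using that by auto
    ultimately show ?case using Suc by blast
  qed
  from this[of "nat i"] show ?thesis by auto
qed

text \<open>The scalar strong law is applied to each matrix entry, a product of two coordinates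
  bounded by \<open>b * b\<close>; there are finitely many entries.\<close>

lemma (in prob_space) second_moment_averages:
  fixes X :: "nat \<Rightarrow> 'a \<Rightarrow> real^'n" and D :: "(real^'n) measure"
  assumes D: "prob_space D" "sets D = sets borel"
    and \<Sigma>: "(\<integral>x. outer x x \<partial>D) = \<Sigma>" and bound: "AE x in D. norm x \<le> b"
    and indep: "indep_vars (\<lambda>_. borel) X {1..}"
    and distr: "\<And>k. 1 \<le> k \<Longrightarrow> distr M borel (X k) = D"
  shows "AE \<omega> in M. (\<lambda>n. (\<Sum>k=1..n. outer (X k \<omega>) (X k \<omega>) - \<Sigma>) /\<^sub>R real n) \<longlonglongrightarrow> 0"
proof -
  interpret D: prob_space D by fact
  have X_meas [measurable]: "random_variable borel (X k)" if "1 \<le> k" for k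
    using indep that unfolding indep_vars_def by blast
  have outer_eq: "outer x x = (\<chi> i. x $ i *\<^sub>R x)" for x :: "real^'n"
    by (simp add: outer_def vec_eq_iff)
  have "continuous_on UNIV (\<lambda>x :: real^'n. outer x x)"
    unfolding outer_eq by (intro continuous_intros)
  then have "(\<lambda>x :: real^'n. outer x x) \<in> borel_measurable D"
    unfolding measurable_cong_sets[OF D(2) refl] by (rule borel_measurable_continuous_onI)
  moreover have "AE x in D. norm (outer x x) \<le> b * b"
    using bound by eventually_elim (auto simp: norm_outer intro!: mult_mono order_trans[OF norm_ge_zero])
  \<comment> \<open>Integrability allows taking entries under the matrix-valued integral that
    defines \<open>\<Sigma>\<close>.\<close>
  ultimately have int: "integrable D (\<lambda>x. outer x x)"
    by (rule D.integrable_const_bound[rotated])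
  have entry: "AE \<omega> in M. (\<lambda>n. (\<Sum>k=1..n. X k \<omega> $ p * X k \<omega> $ q) / real n) \<longlonglongrightarrow> \<Sigma> $ p $ q" for p q
  proof -
    define g where "g x = x $ p * x $ q" for x :: "real^'n"
    have g [measurable]: "g \<in> borel_measurable borel"
      unfolding g_def by (intro borel_measurable_continuous_onI continuous_intros)
    have "bounded_linear (\<lambda>A :: real^'n^'n. A $ p $ q)"
      by (intro bounded_linear_compose[OF bounded_linear_vec_nth bounded_linear_vec_nth])
    from integral_bounded_linear[OF this int] have "(\<integral>x. outer x x $ p $ q \<partial>D) = \<Sigma> $ p $ q"
      unfolding \<Sigma> .
    then have "\<Sigma> $ p $ q = (\<integral>x. g x \<partial>D)"
      by (simp add: outer_def g_def)
    also have "\<dots> = (\<integral>\<omega>. g (X 1 \<omega>) \<partial>M)"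
      by (subst distr[of 1, symmetric]) (auto intro!: integral_distr)
    finally have mean: "expectation (\<lambda>\<omega>. g (X 1 \<omega>)) = \<Sigma> $ p $ q" by simp
    have "AE x in distr M borel (X 1). norm x \<le> b"
      unfolding distr[OF order_refl] by (rule bound)
    then have "AE \<omega> in M. norm (X 1 \<omega>) \<le> b" by (simp add: AE_distr_iff)
    then have g_bound: "AE \<omega> in M. \<bar>g (X 1 \<omega>)\<bar> \<le> b * b"
    proof eventually_elim
      case (elim \<omega>)
      have "\<bar>X 1 \<omega> $ i\<bar> \<le> b" for i
        using component_le_norm_cart[of "X 1 \<omega>" i] elim by linarith
      moreover from this have "0 \<le> b" using abs_ge_zero order_trans by blast
      ultimately show ?case by (auto simp: g_def abs_mult intro!: mult_mono)
    qed
    have g_distr: "distr M borel (\<lambda>\<omega>. g (X k \<omega>)) = distr M borel (\<lambda>\<omega>. g (X 1 \<omega>))" if "1 \<le> k" for k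
    proof -
      have eq: "distr M borel (\<lambda>\<omega>. g (X j \<omega>)) = distr D borel g" if "1 \<le> j" for j
        using distr[OF that] distr_distr[OF g X_meas[OF that]] by (simp add: comp_def)
      show ?thesis using eq[OF that] eq[of 1] by simp
    qed
    have g_indep: "indep_vars (\<lambda>_. borel) (\<lambda>k \<omega>. g (X k \<omega>)) {1..}"
      by (rule indep_vars_compose2[OF indep]) simp
    have "AE \<omega> in M. (\<lambda>n. (\<Sum>k=1..n. g (X k \<omega>)) / real n) \<longlonglongrightarrow> expectation (\<lambda>\<omega>. g (X 1 \<omega>))"
      by (rule bounded_strong_law[OF g_indep g_distr g_bound])
    then show ?thesis unfolding mean unfolding g_def .
  qed
  have "AE \<omega> in M. \<forall>p q. (\<lambda>n. (\<Sum>k=1..n. X k \<omega> $ p * X k \<omega> $ q) / real n) \<longlonglongrightarrow> \<Sigma> $ p $ q"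
    unfolding AE_all_countable using entry by blast
  then show ?thesis
  proof eventually_elim
    case (elim \<omega>)
    show ?case
    proof (intro vec_tendstoI)
      fix p q
      have "(\<lambda>n. (\<Sum>k=1..n. X k \<omega> $ p * X k \<omega> $ q) / real n - \<Sigma> $ p $ q) \<longlonglongrightarrow> \<Sigma> $ p $ q - \<Sigma> $ p $ q"
        using elim by (intro tendsto_intros) auto
      \<comment> \<open>At \<open>n = 0\<close> the left side is minus the entry of
        \<open>\<Sigma>\<close> while the right side is 0, so the identity is claimed
        eventually.\<close>
      moreover have "\<forall>\<^sub>F n in sequentially. (\<Sum>k=1..n. X k \<omega> $ p * X k \<omega> $ q) / real n - \<Sigma> $ p $ q
          = ((\<Sum>k=1..n. outer (X k \<omega>) (X k \<omega>) - \<Sigma>) /\<^sub>R real n) $ p $ q"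
        using eventually_gt_at_top[of 0]
      proof eventually_elim
        case (elim n)
        then show ?case
          by (simp add: outer_def sum_subtractf sum_constant_scaleR field_simps del: sum_constant)
      qed
      ultimately show "(\<lambda>n. ((\<Sum>k=1..n. outer (X k \<omega>) (X k \<omega>) - \<Sigma>) /\<^sub>R real n) $ p $ q) \<longlonglongrightarrow> 0 $ p $ q"
        by (auto intro: Lim_transform_eventually)
    qed
  qed
qed

text \<open>Since \<open>h / h powr (1 - \<gamma>) = h powr \<gamma>\<close>, the delay measured in
  time is at most a constant times \<open>h powr \<gamma>\<close>, which vanishes as
  \<open>\<gamma>\<close> is positive.\<close>

lemma same_order_delay:
  assumes "same_order \<tau> (\<lambda>\<eta>. K / (l * \<eta> powr (1 - \<gamma>)))" and "0 < \<gamma>"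
    and h: "\<And>n. 0 < h n" "h \<longlonglongrightarrow> 0"
  obtains \<theta> where "\<theta> \<longlonglongrightarrow> 0" "\<forall>\<^sub>F n in sequentially. \<forall>j\<ge>1. h n * real (\<tau> (h n) j) \<le> \<theta> n"
proof -
  obtain c C where "\<forall>\<^sub>F \<eta> in at_right 0. \<forall>k>0. c * (K / (l * \<eta> powr (1 - \<gamma>))) \<le> real (\<tau> \<eta> k)
      \<and> real (\<tau> \<eta> k) \<le> C * (K / (l * \<eta> powr (1 - \<gamma>)))"
    using assms(1) unfolding same_order_def by blast
  then have C: "\<forall>\<^sub>F \<eta> in at_right 0. \<forall>k>0. real (\<tau> \<eta> k) \<le> C * (K / (l * \<eta> powr (1 - \<gamma>)))"
    by (auto elim: eventually_mono)
  have lim: "filterlim h (at_right 0) sequentially"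
    using h by (intro tendsto_imp_filterlim_at_right) auto
  define \<theta> where "\<theta> n = C * K / l * h n powr \<gamma>" for n
  have "(\<lambda>n. h n powr \<gamma>) \<longlonglongrightarrow> 0"
    using h assms(2) by (intro tendsto_zero_powrI[where b = \<gamma>]) (auto intro: always_eventually less_imp_le)
  then have "\<theta> \<longlonglongrightarrow> C * K / l * 0"
    unfolding \<theta>_def by (intro tendsto_intros)
  moreover have "\<forall>\<^sub>F n in sequentially. \<forall>j\<ge>1. h n * real (\<tau> (h n) j) \<le> \<theta> n"
    using eventually_compose_filterlim[OF C lim]
  proof eventually_elim
    case (elim n)
    have "h n / h n powr (1 - \<gamma>) = h n powr \<gamma>"
      using h(1)[of n] by (simp add: powr_diff)
    then have \<theta>_eq: "\<theta> n = h n * (C * (K / (l * h n powr (1 - \<gamma>))))"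
      unfolding \<theta>_def by (simp flip: \<open>_ = h n powr \<gamma>\<close>)
    show ?case
      unfolding \<theta>_eq using elim h(1)[of n] by (intro allI impI mult_left_mono) auto
  qed
  ultimately show thesis using that by simp
qed

text \<open>Radius 2 leaves distance 1 around the unit sphere, where the limit lives; 10 and 13 are
  the field constants on that ball. The maximum bounds the samples and the mean together.\<close>

lemma async_msgd_delayed_momentum:
  assumes "async_msgd \<mu> \<eta> \<tau> x v0 v" "0 \<le> \<mu>" "\<mu> < 1" "0 < \<eta>"
    and x: "\<And>k. 1 \<le> k \<Longrightarrow> norm (x k) \<le> b"
  shows "delayed_momentum oja_field 2 10 13 (max (b * b) (norm \<Sigma>)) (\<lambda>k. outer (x k) (x k)) \<Sigma> \<mu> \<eta> \<tau> v0 v"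
proof (rule delayed_momentum.intro)
  show "norm (outer (x k) (x k)) \<le> max (b * b) (norm \<Sigma>)" if "1 \<le> k" for k
  proof -
    have "norm (x k) * norm (x k) \<le> b * b"
      using x[OF that] order_trans[OF norm_ge_zero x[OF that]] by (intro mult_mono) auto
    then show ?thesis by (simp add: norm_outer)
  qed
qed (use assms in \<open>auto simp: linear_oja_field oja_field_bound oja_field_lipschitz
    async_msgd_def async_msgd_gradient\<close>)

theorem theorem3p4:
  fixes D :: "(real^'n) measure" and \<Sigma> :: "real^'n^'n" and Cd :: real
    and lam :: "nat \<Rightarrow> real"
    and M :: "'w measure" and X :: "nat \<Rightarrow> 'w \<Rightarrow> real^'n"
    and \<mu> \<gamma> :: real and \<tau> :: "real \<Rightarrow> nat \<Rightarrow> nat"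
    and v :: "real \<Rightarrow> int \<Rightarrow> 'w \<Rightarrow> real^'n" and v0 :: "real^'n"
  assumes "prob_space D" and "sets D = sets borel"
    and "(\<integral>x. x \<partial>D) = 0" and "(\<integral>x. outer x x \<partial>D) = \<Sigma>"
    and "AE x in D. norm x \<le> Cd"
    and "pos_def \<Sigma>" and "eigenvalues \<Sigma> lam"
    and "\<forall>i\<in>{2..CARD('n)}. lam i < lam 1"
    and "\<forall>i j. 1 \<le> i \<and> i \<le> j \<and> j \<le> CARD('n) \<longrightarrow> lam j \<le> lam i"
    and "lam (CARD('n)) > 0"
    and "prob_space M"
    and "prob_space.indep_vars M (\<lambda>_. borel) X {1..}"
    and "\<forall>k\<ge>1. distr M borel (X k) = D"
    and "0 \<le> \<mu>" and "\<mu> < 1" and "0 < \<gamma>" and "\<gamma> \<le> 1"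
    and "same_order \<tau> (\<lambda>\<eta>. (1 - \<mu>)\<^sup>2 / (lam 1 * \<eta> powr (1 - \<gamma>)))"
    and "norm v0 = 1"
    and "\<forall>\<eta>>0. \<forall>\<omega>\<in>space M. async_msgd \<mu> \<eta> (\<tau> \<eta>) (\<lambda>k. X k \<omega>) v0 (\<lambda>k. v \<eta> k \<omega>)"
  shows "\<forall>h. (\<forall>n. h n > 0) \<and> h \<longlonglongrightarrow> 0 \<longrightarrow>
    (\<exists>r :: nat \<Rightarrow> nat. strict_mono r \<and>
      (\<exists>(N :: (real \<Rightarrow> real^'n) measure) V. prob_space N \<and>
        converges_weakly skorokhod_topology
          M (\<lambda>n \<omega>. interpolation (h (r n)) (\<lambda>k. v (h (r n)) k \<omega>)) N V \<and>
        (AE \<omega> in N. solves_limit_ode \<mu> \<Sigma> v0 (V \<omega>))))"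
proof (intro allI impI, elim conjE)
  fix h :: "nat \<Rightarrow> real"
  assume h_pos: "\<forall>n. h n > 0" and h_lim: "h \<longlonglongrightarrow> 0"
  interpret M: prob_space M by fact
  define c where "c = 1 / (1 - \<mu>)"
  have c: "0 < c" using \<open>\<mu> < 1\<close> by (simp add: c_def)
  \<comment> \<open>The factor \<open>1 / (1 - \<mu>)\<close> is absorbed into the matrix, so the
    limit is Oja's flow for \<open>c *\<^sub>R \<Sigma>\<close>.\<close>
  have "0 \<le> x \<bullet> ((c *\<^sub>R \<Sigma>) *v x)" for x
    using \<open>pos_def \<Sigma>\<close> c unfolding pos_def_def
    by (cases "x = 0") (auto simp: scaleR_matrix_vector_assoc[symmetric] intro: less_imp_le)
  from oja_flow_exists[OF this \<open>norm v0 = 1\<close>] obtain U where U: "U 0 = v0"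
    "\<And>t. 0 \<le> t \<Longrightarrow> norm (U t) = 1"
    "\<And>t. 0 \<le> t \<Longrightarrow> (U has_vector_derivative
       (c *\<^sub>R \<Sigma>) *v U t - (U t \<bullet> ((c *\<^sub>R \<Sigma>) *v U t)) *\<^sub>R U t) (at t within {0..})"
    by blast
  have U_ode: "(U has_vector_derivative (1 / (1 - \<mu>)) *\<^sub>R oja_field \<Sigma> (U t)) (at t within {0..})"
    if "0 \<le> t" for t
    using U(3)[OF that]
    by (simp add: oja_field_def c_def[symmetric] scaleR_matrix_vector_assoc[symmetric] scaleR_diff_right)
  define V where "V = restrict U {0..}"
  have "continuous_on {0..} U"
    by (rule continuous_on_vector_derivative) (use U_ode in auto)
  then have V_path: "V \<in> cadlag_paths" unfolding V_def by (rule continuous_cadlag)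
  have V_ode: "solves_limit_ode \<mu> \<Sigma> v0 V"
    unfolding solves_limit_ode_def
  proof (intro conjI allI impI)
    show "V 0 = v0" using U(1) by (simp add: V_def)
    fix t :: real assume "0 \<le> t"
    then have "(V has_vector_derivative (1 / (1 - \<mu>)) *\<^sub>R oja_field \<Sigma> (U t)) (at t within {0..})"
      by (intro has_vector_derivative_transform[OF _ _ U_ode]) (auto simp: V_def)
    then show "(V has_vector_derivative
        (1 / (1 - \<mu>)) *\<^sub>R (\<Sigma> *v V t - (V t \<bullet> (\<Sigma> *v V t)) *\<^sub>R V t)) (at t within {0..})"
      using \<open>0 \<le> t\<close> by (simp add: V_def oja_field_def)
  qed
  obtain \<theta> where \<theta>: "\<theta> \<longlonglongrightarrow> 0" "\<forall>\<^sub>F n in sequentially. \<forall>j\<ge>1. h n * real (\<tau> (h n) j) \<le> \<theta> n"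
    using same_order_delay[OF assms(18) \<open>0 < \<gamma>\<close> _ h_lim] h_pos by blast
  have X_meas: "X k \<in> borel_measurable M" if "1 \<le> k" for k
    using assms(12) that unfolding M.indep_vars_def by blast
  have X_bound: "AE \<omega> in M. norm (X k \<omega>) \<le> Cd" if "1 \<le> k" for k
  proof -
    have "AE x in distr M borel (X k). norm x \<le> Cd"
      unfolding assms(13)[rule_format, OF that] by fact
    then show ?thesis using X_meas[OF that] by (simp add: AE_distr_iff)
  qed
  have "AE \<omega> in M. \<forall>k. 1 \<le> k \<longrightarrow> norm (X k \<omega>) \<le> Cd"
    unfolding AE_all_countable using X_bound by (auto intro: AE_I2)
  moreover have "AE \<omega> in M. (\<lambda>n. (\<Sum>k=1..n. outer (X k \<omega>) (X k \<omega>) - \<Sigma>) /\<^sub>R real n) \<longlonglongrightarrow> 0"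
    using M.second_moment_averages[OF assms(1,2,4,5,12)] assms(13) by blast
  moreover have "AE \<omega> in M. \<omega> \<in> space M" by (rule AE_space)
  ultimately have unif: "AE \<omega> in M. \<forall>m::nat. \<forall>i::nat. \<forall>\<^sub>F n in sequentially.
      \<forall>t\<in>{0..real m}. dist (interpolation (h n) (\<lambda>k. v (h n) k \<omega>) t) (V t) < inverse (real (Suc i))"
  proof eventually_elim
    case (elim \<omega>)
    show ?case
    proof (intro allI)
      fix m i :: nat
      have "delayed_momentum oja_field 2 10 13 (max (Cd * Cd) (norm \<Sigma>))
          (\<lambda>k. outer (X k \<omega>) (X k \<omega>)) \<Sigma> \<mu> (h n) (\<tau> (h n)) v0 (\<lambda>k. v (h n) k \<omega>)" for n
        using assms(14,15,20) h_pos elim by (intro async_msgd_delayed_momentum) auto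
      \<comment> \<open>The horizon \<open>m + 1\<close> is positive even for \<open>m = 0\<close>,
        as the convergence theorem requires.\<close>
      then have "\<forall>\<^sub>F n in sequentially. \<forall>t\<in>{0..real m + 1}.
          dist (v (h n) \<lfloor>t / h n\<rfloor> \<omega>) (U t) < inverse (real (Suc i))"
        by (rule delayed_momentum_converges[where V = U and R' = 1 and \<theta> = \<theta>])
          (use h_lim \<theta> elim(2) U U_ode in auto)
      then show "\<forall>\<^sub>F n in sequentially. \<forall>t\<in>{0..real m}.
          dist (interpolation (h n) (\<lambda>k. v (h n) k \<omega>) t) (V t) < inverse (real (Suc i))"
        by eventually_elim (auto simp: interpolation_def V_def)
    qed
  qed
  \<comment> \<open>The limit is deterministic: a point mass on the path space carries the constant
    process \<open>V\<close>.\<close>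
  define N where "N = return (borel_of skorokhod_topology) V"
  have N: "prob_space N"
    unfolding N_def using V_path
    by (intro prob_space_return) (simp add: space_borel_of topspace_skorokhod)
  have meas: "(\<lambda>\<omega>. interpolation (h n) (\<lambda>k. v (h n) k \<omega>)) \<in> M \<rightarrow>\<^sub>M borel_of skorokhod_topology" for n
    using assms(20) h_pos
    by (intro interpolation_measurable async_msgd_measurable[OF X_meas]) auto
  have "converges_weakly skorokhod_topology M
      (\<lambda>n \<omega>. interpolation (h n) (\<lambda>k. v (h n) k \<omega>)) N (\<lambda>_. V)"
    by (rule converges_weakly_to_point[OF M.prob_space_axioms N meas V_path unif])
  \<comment> \<open>The whole sequence converges, so the identity serves as the subsequence.\<close>
  then show "\<exists>r :: nat \<Rightarrow> nat. strict_mono r \<and>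
      (\<exists>(N :: (real \<Rightarrow> real^'n) measure) V. prob_space N \<and>
        converges_weakly skorokhod_topology
          M (\<lambda>n \<omega>. interpolation (h (r n)) (\<lambda>k. v (h (r n)) k \<omega>)) N V \<and>
        (AE \<omega> in N. solves_limit_ode \<mu> \<Sigma> v0 (V \<omega>)))"
    using N V_ode
    by (intro exI[of _ "\<lambda>n. n"] conjI exI[of _ N] exI[of _ "\<lambda>_. V"]) (auto simp: strict_mono_def)
qed

end
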